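(* Consider ${\rm APP}=\{{\rm APP}_{\infty,d}\}_{d\in\mathbb N}$ in the worst case setting for the absolute or normalized error criterion $\star\in\{{\rm ABS},{\rm NOR}\}$. Then ALG-PT for $\Lambda^{\rm all}$ is equivalent to ALG-PT for $\Lambda^{\rm std}$; and ALG-SPT for $\Lambda^{\rm all}$ is equivalent to ALG-SPT for $\Lambda^{\rm std}$, in which case ${\rm ALG}\text{-}p^\star(\Lambda^{\rm all})={\rm ALG}\text{-}p^\star(\Lambda^{\rm std})$.
   Context: $\mathbb T^d=[0,1]^d$ is the torus with Lebesgue measure; $\hat f(\mathbf k)=\int f(\mathbf x)e^{-2\pi i\mathbf k\cdot\mathbf x}d\mathbf x$. For each $d$ let $\omega_d:\mathbb Z^d\to(0,\infty)$ with $\sum_{\mathbf k}\omega_d(\mathbf k)^{-2}<\infty$, and $H^{\omega_d}(\mathbb T^d)$ the Hilbert space of $f\in L_2(\mathbb T^d)$ with $\|f\|^2=\sum_{\mathbf k}|\hat f(\mathbf k)|^2\omega_d(\mathbf k)^2<\infty$. ${\rm APP}_{\infty,d}:H^{\omega_d}(\mathbb T^d)\to L_\infty(\mathbb T^d)$ (sup norm), $f\mapsto f$. $\Lambda^{\rm all}$: all continuous linear functionals; $\Lambda^{\rm std}$: point evaluations. $e(n,{\rm APP}_{\infty,d};\Lambda)$: infimum over algorithms $A(f)=\phi(L_1f,\dots,L_nf)$, $L_i\in\Lambda$, $\phi$ arbitrary, of $\sup_{\|f\|\le1}\|f-A(f)\|_\infty$; $e(0,{\rm APP}_{\infty,d})=\sup_{\|f\|\le1}\|f\|_\infty$.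 $n^\star(\varepsilon,d;\Lambda)=\inf\{n\ge0:e(n,{\rm APP}_{\infty,d};\Lambda)\le\varepsilon{\rm CRI}_d\}$ with ${\rm CRI}_d=1$ (ABS) or $e(0,{\rm APP}_{\infty,d})$ (NOR). ALG-PT for $\Lambda$: there exist $C>0$, $p,q\ge0$ with $n^\star(\varepsilon,d;\Lambda)\le Cd^q\varepsilon^{-p}$ for all $d\in\mathbb N,\varepsilon\in(0,1)$. ALG-SPT: the same with $q=0$; ${\rm ALG}\text{-}p^\star(\Lambda)$ is the infimum of such $p$. *)

theory Defs
  imports "HOL-Analysis.Analysis"
begin

type_synonym pt = "nat \<Rightarrow> real"
type_synonym fn = "pt \<Rightarrow> complex"
type_synonym freq = "nat \<Rightarrow> int"
type_synonym weight = "nat \<Rightarrow> freq \<Rightarrow> real"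

definition Zd :: "nat \<Rightarrow> freq set" where
  "Zd d = {k. \<forall>i\<ge>d. k i = 0}"

definition torus :: "nat \<Rightarrow> pt set" where
  "torus d = PiE {..<d} (\<lambda>_. {0..1})"

definition Tmeas :: "nat \<Rightarrow> pt measure" where
  "Tmeas d = PiM {..<d} (\<lambda>_. restrict_space lborel {0..1::real})"

definition ekx :: "nat \<Rightarrow> freq \<Rightarrow> pt \<Rightarrow> complex" where
  "ekx d k x = cis (2 * pi * (\<Sum>i<d. real_of_int (k i) * x i))"

definition fhat :: "nat \<Rightarrow> fn \<Rightarrow> freq \<Rightarrow> complex" where
  "fhat d f k = integral\<^sup>L (Tmeas d) (\<lambda>x. f x * cnj (ekx d k x))"

text \<open>The space H^{omega_d}: square integrable functions on the torus with finite
  weighted norm; each element is taken as its (continuous) representative given by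
  its (absolutely convergent) Fourier series, so that point evaluation is meaningful.\<close>
definition Hsp :: "weight \<Rightarrow> nat \<Rightarrow> fn set" where
  "Hsp \<omega> d = {f. (\<forall>x. x \<notin> torus d \<longrightarrow> f x = 0)
      \<and> f \<in> borel_measurable (Tmeas d)
      \<and> integrable (Tmeas d) (\<lambda>x. (cmod (f x))\<^sup>2)
      \<and> (\<lambda>k. (cmod (fhat d f k))\<^sup>2 * (\<omega> d k)\<^sup>2) summable_on Zd d
      \<and> (\<forall>x\<in>torus d. ((\<lambda>k. fhat d f k * ekx d k x) has_sum f x) (Zd d))}"

definition Hnorm :: "weight \<Rightarrow> nat \<Rightarrow> fn \<Rightarrow> real" where
  "Hnorm \<omega> d f = sqrt (\<Sum>\<^sub>\<infinity>k\<in>Zd d. (cmod (fhat d f k))\<^sup>2 * (\<omega> d k)\<^sup>2)"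

definition Lall :: "weight \<Rightarrow> nat \<Rightarrow> (fn \<Rightarrow> complex) set" where
  "Lall \<omega> d = {L. (\<forall>f\<in>Hsp \<omega> d. \<forall>g\<in>Hsp \<omega> d. \<forall>a b::complex.
        L (\<lambda>x. a * f x + b * g x) = a * L f + b * L g)
      \<and> (\<exists>C. \<forall>f\<in>Hsp \<omega> d. cmod (L f) \<le> C * Hnorm \<omega> d f)}"

definition Lstd :: "nat \<Rightarrow> (fn \<Rightarrow> complex) set" where
  "Lstd d = {L. \<exists>x\<in>torus d. L = (\<lambda>f. f x)}"

definition Linf :: "nat \<Rightarrow> fn \<Rightarrow> ereal" where
  "Linf d g = Inf {z. \<exists>N\<in>null_sets (Tmeas d). \<forall>x\<in>torus d - N. ereal (cmod (g x)) \<le> z}"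

definition unitball :: "weight \<Rightarrow> nat \<Rightarrow> fn set" where
  "unitball \<omega> d = {f\<in>Hsp \<omega> d. Hnorm \<omega> d f \<le> 1}"

definition err :: "weight \<Rightarrow> nat \<Rightarrow> (fn \<Rightarrow> complex) set \<Rightarrow> nat \<Rightarrow> ereal" where
  "err \<omega> d Lam n = (INF Lphi \<in> {(Ls, \<phi>). length Ls = n \<and> set Ls \<subseteq> Lam}.
      (SUP f \<in> unitball \<omega> d.
         Linf d (\<lambda>x. f x - (snd Lphi) (map (\<lambda>L. L f) (fst Lphi)) x)))"

definition init_err :: "weight \<Rightarrow> nat \<Rightarrow> ereal" where
  "init_err \<omega> d = (SUP f \<in> unitball \<omega> d. Linf d f)"

datatype crit = ABS | NOR

definition CRI :: "crit \<Rightarrow> weight \<Rightarrow> nat \<Rightarrow> ereal" where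
  "CRI c \<omega> d = (case c of ABS \<Rightarrow> 1 | NOR \<Rightarrow> init_err \<omega> d)"

text \<open>Information complexity; infinity if no n works.\<close>
definition nstar :: "crit \<Rightarrow> weight \<Rightarrow> (nat \<Rightarrow> (fn \<Rightarrow> complex) set) \<Rightarrow> real \<Rightarrow> nat \<Rightarrow> enat" where
  "nstar c \<omega> Lam \<epsilon> d = Inf {enat n | n. err \<omega> d (Lam d) n \<le> ereal \<epsilon> * CRI c \<omega> d}"

definition bound_holds :: "crit \<Rightarrow> weight \<Rightarrow> (nat \<Rightarrow> (fn \<Rightarrow> complex) set) \<Rightarrow> real \<Rightarrow> real \<Rightarrow> real \<Rightarrow> bool" where
  "bound_holds c \<omega> Lam C p q \<longleftrightarrow> (\<forall>d\<ge>1. \<forall>\<epsilon>. 0 < \<epsilon> \<and> \<epsilon> < 1 \<longrightarrow>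
      (\<exists>n. nstar c \<omega> Lam \<epsilon> d = enat n \<and> real n \<le> C * real d powr q * \<epsilon> powr (-p)))"

definition ALG_PT :: "crit \<Rightarrow> weight \<Rightarrow> (nat \<Rightarrow> (fn \<Rightarrow> complex) set) \<Rightarrow> bool" where
  "ALG_PT c \<omega> Lam \<longleftrightarrow> (\<exists>C>0. \<exists>p\<ge>0. \<exists>q\<ge>0. bound_holds c \<omega> Lam C p q)"

definition ALG_SPT :: "crit \<Rightarrow> weight \<Rightarrow> (nat \<Rightarrow> (fn \<Rightarrow> complex) set) \<Rightarrow> bool" where
  "ALG_SPT c \<omega> Lam \<longleftrightarrow> (\<exists>C>0. \<exists>p\<ge>0. bound_holds c \<omega> Lam C p 0)"

definition ALG_pstar :: "crit \<Rightarrow> weight \<Rightarrow> (nat \<Rightarrow> (fn \<Rightarrow> complex) set) \<Rightarrow> real" where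
  "ALG_pstar c \<omega> Lam = Inf {p. p \<ge> 0 \<and> (\<exists>C>0. bound_holds c \<omega> Lam C p 0)}"

end

theory Submission
  imports Defs "Jordan_Normal_Form.Determinant" "HOL-Library.Real_Mod"
begin

text \<open>
  Put \<open>\<lambda> = \<omega>\<^sup>-\<^sup>2\<close> and let \<open>t\<close> be the sum of all \<open>\<lambda>\<close> except the \<open>m\<close> largest ones. Averaging the
  reproducing kernel of the null space of \<open>m\<close> linear functionals over a grid shows that every
  algorithm using \<open>m\<close> functionals has error at least \<open>\<surd>t\<close>.

  Conversely let \<open>D\<^sub>n\<close> be the supremum of the Gram determinant of the kernel at \<open>n\<close> points. At points
  that nearly attain \<open>D\<^sub>n\<close>, every function of norm at most 1 that vanishes there is bounded by
  \<open>\<surd>(2 D\<^sub>n\<^sub>+\<^sub>1 / D\<^sub>n)\<close>. The Cauchy-Binet formula expresses the Gram determinant through the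
  elementary symmetric sums \<open>e\<^sub>n(\<lambda>)\<close>: averaging over a grid gives \<open>D\<^sub>m \<ge> m! e\<^sub>m(\<lambda>)\<close>, Hadamard's inequality
  gives \<open>D\<^sub>2\<^sub>m \<le> (2m)\<^sup>2\<^sup>m e\<^sub>2\<^sub>m(\<lambda>)\<close>, and up to a factor \<open>C\<^sup>m\<close> the sum \<open>e\<^sub>2\<^sub>m(\<lambda>)\<close> is at most \<open>e\<^sub>m(\<lambda>) t\<^sup>m / m!\<close>. Hence
  \<open>D\<^sub>2\<^sub>m / D\<^sub>m \<le> (C t)\<^sup>m\<close>, so that \<open>D\<^sub>n\<^sub>+\<^sub>1 / D\<^sub>n \<le> C t\<close> for some \<open>n\<close> between \<open>m\<close> and \<open>2 m\<close>. Up to constants,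
  \<open>2 m\<close> function values therefore do as well as \<open>m\<close> arbitrary functionals, with the same exponents.
\<close>

section \<open>Gram determinants\<close>

definition gram :: "('x \<Rightarrow> 'x \<Rightarrow> complex) \<Rightarrow> nat \<Rightarrow> (nat \<Rightarrow> 'x) \<Rightarrow> complex" where
  "gram K n x = Determinant.det (Matrix.mat n n (\<lambda>(i, j). K (x i) (x j)))"

lemma gram_0 [simp]: "gram K 0 x = 1"
  unfolding gram_def by (rule det_dim_zero) simp

lemma permutes_lessThan: "p permutes {0..<n} \<Longrightarrow> i < n \<Longrightarrow> p i < (n :: nat)"
  using permutes_in_image[of p "{0..<n}" i] by simp

lemma gram_permutes:
  "gram K n x = (\<Sum>p | p permutes {0..<n}. of_int (sign p) * (\<Prod>i = 0..<n. K (x i) (x (p i))))"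
  unfolding gram_def
  by (subst det_def'[of _ n]) (auto intro!: sum.cong prod.cong simp: permutes_lessThan)

text \<open>\<open>C\<close> is the row of the adjugate belonging to the last point. The adjugate
  times the matrix is the determinant times the identity; row \<open>n\<close> of this identity
  gives the last two claims, also for a singular matrix.\<close>

lemma gram_cofactors:
  obtains C where "C n = gram K n x"
    and "\<And>j. j < n \<Longrightarrow> (\<Sum>i\<le>n. C i * K (x i) (x j)) = 0"
    and "(\<Sum>i\<le>n. C i * K (x i) (x n)) = gram K (Suc n) x"
proof -
  define A where "A = Matrix.mat (Suc n) (Suc n) (\<lambda>(i, j). K (x i) (x j))"
  define C where "C i = adj_mat A $$ (n, i)" for i
  have A: "A \<in> carrier_mat (Suc n) (Suc n)" by (simp add: A_def)
  note adj = adj_mat[OF A]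
  have "(\<Sum>i\<le>n. C i * K (x i) (x j)) = (Determinant.det A \<cdot>\<^sub>m 1\<^sub>m (Suc n)) $$ (n, j)" if "j \<le> n" for j
  proof -
    have "(adj_mat A * A) $$ (n, j) = (\<Sum>i = 0..<Suc n. adj_mat A $$ (n, i) * A $$ (i, j))"
      using adj(1) A that by (simp add: scalar_prod_def)
    also have "\<dots> = (\<Sum>i\<le>n. C i * K (x i) (x j))"
      using that by (intro sum.cong) (auto simp: C_def A_def)
    finally show ?thesis by (simp add: adj(3))
  qed
  \<comment> \<open>\<open>C n\<close> is the corner cofactor: deleting the last row and column
    leaves the matrix of the first \<open>n\<close> points, and the sign exponent
    \<open>n + n\<close> is even.\<close>
  moreover have "mat_delete A n n = Matrix.mat n n (\<lambda>(i, j). K (x i) (x j))"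
    by (rule eq_matI) (auto simp: mat_delete_def A_def)
  then have "C n = gram K n x"
    by (simp add: C_def adj_mat_def A_def[symmetric] cofactor_def gram_def)
       (simp add: A_def adj_mat_def cofactor_def)
  ultimately show ?thesis
    by (intro that[of C]) (auto simp: gram_def A_def)
qed

lemma has_sum_finite_sum:
  fixes f :: "'i \<Rightarrow> 'a \<Rightarrow> 'b :: {topological_comm_monoid_add}"
  assumes "finite I" "\<And>i. i \<in> I \<Longrightarrow> (f i has_sum s i) A"
  shows "((\<lambda>k. \<Sum>i\<in>I. f i k) has_sum (\<Sum>i\<in>I. s i)) A"
  using assms by (induction I rule: finite_induct) (auto intro!: has_sum_add)

text \<open>Cauchy-Schwarz for the factors \<open>c k / sqrt (l k)\<close> and
  \<open>sqrt (l k) * u k\<close>. The first sum is the squared weighted norm of a function with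
  coefficients \<open>c\<close>.\<close>

lemma cmod_sum_mult_le_weighted:
  fixes c u :: "'k \<Rightarrow> complex"
  assumes "\<And>k. k \<in> F \<Longrightarrow> 0 < l k"
  shows "(cmod (\<Sum>k\<in>F. c k * u k))\<^sup>2 \<le> (\<Sum>k\<in>F. (cmod (c k))\<^sup>2 / l k) * (\<Sum>k\<in>F. l k * (cmod (u k))\<^sup>2)"
proof -
  have "cmod (\<Sum>k\<in>F. c k * u k) \<le> (\<Sum>k\<in>F. \<bar>cmod (c k) / sqrt (l k)\<bar> * \<bar>sqrt (l k) * cmod (u k)\<bar>)"
    using assms by (intro order_trans[OF norm_sum] sum_mono) (auto simp: norm_mult abs_mult dest: assms)
  also have "\<dots> \<le> L2_set (\<lambda>k. cmod (c k) / sqrt (l k)) F * L2_set (\<lambda>k. sqrt (l k) * cmod (u k)) F"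
    by (rule L2_set_mult_ineq)
  finally have "(cmod (\<Sum>k\<in>F. c k * u k))\<^sup>2 \<le>
      (L2_set (\<lambda>k. cmod (c k) / sqrt (l k)) F * L2_set (\<lambda>k. sqrt (l k) * cmod (u k)) F)\<^sup>2"
    by (rule power_mono) simp
  also have "\<dots> = (\<Sum>k\<in>F. (cmod (c k))\<^sup>2 / l k) * (\<Sum>k\<in>F. l k * (cmod (u k))\<^sup>2)"
    using assms less_imp_le[OF assms]
    by (auto simp: power_mult_distrib L2_set_def power_divide sum_nonneg intro!: arg_cong2[where f="(*)"] sum.cong)
  finally show ?thesis .
qed

text \<open>The cofactors \<open>C\<close> of the last column make \<open>\<Sum>i. C i * K (x i)\<close> orthogonal to the first \<open>n\<close> kernel
  sections; the bound is the Cauchy-Schwarz inequality for this vector, and it needs no invertibility.\<close>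
lemma gram_duality:
  fixes e :: "'k \<Rightarrow> 'x \<Rightarrow> complex"
  assumes l: "\<And>k. k \<in> Z \<Longrightarrow> 0 < l k"
    and K: "\<And>i j. i \<le> n \<Longrightarrow> j \<le> n \<Longrightarrow>
      ((\<lambda>k. of_real (l k) * e k (x i) * cnj (e k (x j))) has_sum K (x i) (x j)) Z"
    and c: "\<And>F. finite F \<Longrightarrow> F \<subseteq> Z \<Longrightarrow> (\<Sum>k\<in>F. (cmod (c k))\<^sup>2 / l k) \<le> M"
    and h: "\<And>i. i \<le> n \<Longrightarrow> ((\<lambda>k. c k * e k (x i)) has_sum h i) Z"
    and C: "C n = gram K n x" "\<And>j. j < n \<Longrightarrow> (\<Sum>i\<le>n. C i * K (x i) (x j)) = 0"
      "(\<Sum>i\<le>n. C i * K (x i) (x n)) = gram K (Suc n) x"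
  shows "(cmod (\<Sum>i\<le>n. C i * h i))\<^sup>2 \<le> M * (cmod (gram K n x) * cmod (gram K (Suc n) x))"
proof -
  \<comment> \<open>\<open>u\<close> collects the functional \<open>\<Sum>i\<le>n. C i * h i\<close>
    frequency by frequency: on a function with coefficients \<open>c\<close> it is the sum of
    \<open>c k * u k\<close>.\<close>
  define u where "u k = (\<Sum>i\<le>n. C i * e k (x i))" for k
  have "((\<lambda>k. \<Sum>i\<le>n. C i * (c k * e k (x i))) has_sum (\<Sum>i\<le>n. C i * h i)) Z"
    by (intro has_sum_finite_sum has_sum_cmult_right h) auto
  then have 1: "((\<lambda>k. c k * u k) has_sum (\<Sum>i\<le>n. C i * h i)) Z"
    by (simp add: u_def sum_distrib_left mult_ac)
  have "((\<lambda>k. \<Sum>j\<le>n. \<Sum>i\<le>n. cnj (C j) * C i * (of_real (l k) * e k (x i) * cnj (e k (x j)))) has_sum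
     (\<Sum>j\<le>n. \<Sum>i\<le>n. cnj (C j) * C i * K (x i) (x j))) Z"
    by (intro has_sum_finite_sum has_sum_cmult_right K) auto
  moreover have "(\<Sum>j\<le>n. \<Sum>i\<le>n. cnj (C j) * C i * (of_real (l k) * e k (x i) * cnj (e k (x j))))
      = of_real (l k * (cmod (u k))\<^sup>2)" for k
    unfolding of_real_mult complex_norm_square u_def cnj_sum complex_cnj_mult
    by (simp add: sum_product sum_distrib_left mult_ac)
  \<comment> \<open>The quadratic form of the kernel matrix at \<open>C\<close> collapses to its
    last column, since \<open>C\<close> annihilates the earlier ones.\<close>
  moreover have "(\<Sum>j\<le>n. \<Sum>i\<le>n. cnj (C j) * C i * K (x i) (x j)) = cnj (gram K n x) * gram K (Suc n) x"
  proof -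
    have "(\<Sum>j\<le>n. \<Sum>i\<le>n. cnj (C j) * C i * K (x i) (x j)) = (\<Sum>j\<le>n. cnj (C j) * (\<Sum>i\<le>n. C i * K (x i) (x j)))"
      by (simp add: sum_distrib_left mult_ac)
    also have "\<dots> = (\<Sum>j\<le>n. if j = n then cnj (C j) * gram K (Suc n) x else 0)"
      using C(2,3) by (intro sum.cong) auto
    finally show ?thesis by (simp add: C(1))
  qed
  ultimately have 2: "((\<lambda>k. of_real (l k * (cmod (u k))\<^sup>2)) has_sum (cnj (gram K n x) * gram K (Suc n) x)) Z"
    by simp
  have M: "0 \<le> M" using c[of "{}"] by simp
  have lim1: "((\<lambda>F. (cmod (\<Sum>k\<in>F. c k * u k))\<^sup>2) \<longlongrightarrow> (cmod (\<Sum>i\<le>n. C i * h i))\<^sup>2) (finite_subsets_at_top Z)"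
    using 1 unfolding has_sum_def by (intro tendsto_intros)
  have lim2: "((\<lambda>F. M * cmod (\<Sum>k\<in>F. of_real (l k * (cmod (u k))\<^sup>2))) \<longlongrightarrow>
      M * cmod (cnj (gram K n x) * gram K (Suc n) x)) (finite_subsets_at_top Z)"
    using 2 unfolding has_sum_def by (intro tendsto_intros)
  have "(cmod (\<Sum>k\<in>F. c k * u k))\<^sup>2 \<le> M * cmod (\<Sum>k\<in>F. of_real (l k * (cmod (u k))\<^sup>2))"
    if F: "finite F" "F \<subseteq> Z" for F
  proof -
    have "(cmod (\<Sum>k\<in>F. c k * u k))\<^sup>2 \<le> (\<Sum>k\<in>F. (cmod (c k))\<^sup>2 / l k) * (\<Sum>k\<in>F. l k * (cmod (u k))\<^sup>2)"
      using F l by (intro cmod_sum_mult_le_weighted) auto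
    also have "\<dots> \<le> M * (\<Sum>k\<in>F. l k * (cmod (u k))\<^sup>2)"
      using F l by (intro mult_right_mono c sum_nonneg) (auto simp: less_imp_le subset_iff)
    also have "\<dots> \<le> M * cmod (\<Sum>k\<in>F. of_real (l k * (cmod (u k))\<^sup>2))"
      using M by (intro mult_left_mono) (auto simp flip: of_real_sum simp del: of_real_mult)
    finally show ?thesis .
  qed
  then have "(cmod (\<Sum>i\<le>n. C i * h i))\<^sup>2 \<le> M * cmod (cnj (gram K n x) * gram K (Suc n) x)"
    by (intro tendsto_le[OF _ lim2 lim1] eventually_finite_subsets_at_top_weakI) auto
  then show ?thesis by (simp add: norm_mult)
qed

text \<open>Only the last term of \<open>\<Sum>i\<le>n. C i * h i\<close> survives, equal to
  \<open>gram K n x * h n\<close>, and one factor cancels in \<open>gram_duality\<close>. For a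
  nonzero \<open>gram K n x\<close>, the quotient of the two determinants is the squared power
  function: the squared distance of the last kernel section from the span of the others.\<close>

lemma gram_power_function:
  fixes e :: "'k \<Rightarrow> 'x \<Rightarrow> complex"
  assumes l: "\<And>k. k \<in> Z \<Longrightarrow> 0 < l k"
    and K: "\<And>i j. i \<le> n \<Longrightarrow> j \<le> n \<Longrightarrow>
      ((\<lambda>k. of_real (l k) * e k (x i) * cnj (e k (x j))) has_sum K (x i) (x j)) Z"
    and c: "\<And>F. finite F \<Longrightarrow> F \<subseteq> Z \<Longrightarrow> (\<Sum>k\<in>F. (cmod (c k))\<^sup>2 / l k) \<le> M"
    and h: "\<And>i. i \<le> n \<Longrightarrow> ((\<lambda>k. c k * e k (x i)) has_sum h i) Z"
    and 0: "\<And>i. i < n \<Longrightarrow> h i = 0"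
  shows "(cmod (h n))\<^sup>2 * cmod (gram K n x) \<le> M * cmod (gram K (Suc n) x)"
proof -
  obtain C where C: "C n = gram K n x" "\<And>j. j < n \<Longrightarrow> (\<Sum>i\<le>n. C i * K (x i) (x j)) = 0"
      "(\<Sum>i\<le>n. C i * K (x i) (x n)) = gram K (Suc n) x"
    by (rule gram_cofactors[of n K x]) blast
  have "(\<Sum>i\<le>n. C i * h i) = (\<Sum>i\<le>n. if i = n then C i * h i else 0)"
    using 0 by (intro sum.cong) auto
  then have "(\<Sum>i\<le>n. C i * h i) = gram K n x * h n" by (simp add: C(1))
  with gram_duality[of Z l n e x K c M h C, OF l K c h C]
  have *: "cmod (gram K n x) * ((cmod (h n))\<^sup>2 * cmod (gram K n x)) \<le> cmod (gram K n x) * (M * cmod (gram K (Suc n) x))"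
    by (simp add: norm_mult power2_eq_square mult_ac)
  \<comment> \<open>Nonnegativity settles the degenerate case \<open>gram K n x = 0\<close>, where
    the left side vanishes.\<close>
  have "0 \<le> M" using c[of "{}"] by simp
  then show ?thesis
    using * by (cases "gram K n x = 0") auto
qed

text \<open>One step of Hadamard's inequality: \<open>gram_duality\<close> is applied to the kernel
  section at the last point itself. Then the sum over \<open>C\<close> is
  \<open>gram K (Suc n) x\<close>, the bound \<open>M\<close> is the diagonal value of the kernel,
  and one factor cancels.\<close>

lemma gram_Suc_le:
  fixes e :: "'k \<Rightarrow> 'x \<Rightarrow> complex"
  assumes l: "\<And>k. k \<in> Z \<Longrightarrow> 0 < l k" and Z: "finite Z"
  defines "K \<equiv> (\<lambda>y z. \<Sum>k\<in>Z. of_real (l k) * e k y * cnj (e k z))"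
  shows "cmod (gram K (Suc n) x) \<le> cmod (gram K n x) * (\<Sum>k\<in>Z. l k * (cmod (e k (x n)))\<^sup>2)"
proof -
  obtain C where C: "C n = gram K n x" "\<And>j. j < n \<Longrightarrow> (\<Sum>i\<le>n. C i * K (x i) (x j)) = 0"
      "(\<Sum>i\<le>n. C i * K (x i) (x n)) = gram K (Suc n) x"
    by (rule gram_cofactors[of n K x]) blast
  have "(cmod (\<Sum>i\<le>n. C i * K (x i) (x n)))\<^sup>2 \<le> (\<Sum>k\<in>Z. l k * (cmod (e k (x n)))\<^sup>2) *
      (cmod (gram K n x) * cmod (gram K (Suc n) x))"
  proof (rule gram_duality[where Z=Z and l=l and e=e and c="\<lambda>k. of_real (l k) * cnj (e k (x n))"])
    show "((\<lambda>k. of_real (l k) * e k (x i) * cnj (e k (x j))) has_sum K (x i) (x j)) Z" for i j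
      unfolding K_def by (rule has_sum_finite[OF Z])
    have "(\<lambda>k. of_real (l k) * cnj (e k (x n)) * e k (x i)) = (\<lambda>k. of_real (l k) * e k (x i) * cnj (e k (x n)))" for i
      by (simp add: mult_ac)
    then show "((\<lambda>k. of_real (l k) * cnj (e k (x n)) * e k (x i)) has_sum K (x i) (x n)) Z" for i
      unfolding K_def by (simp only:) (rule has_sum_finite[OF Z])
    fix F assume F: "finite F" "F \<subseteq> Z"
    have "(\<Sum>k\<in>F. (cmod (of_real (l k) * cnj (e k (x n))))\<^sup>2 / l k) = (\<Sum>k\<in>F. l k * (cmod (e k (x n)))\<^sup>2)"
      using F by (intro sum.cong refl) (use l in \<open>force simp: norm_mult power2_eq_square\<close>)
    also have "\<dots> \<le> (\<Sum>k\<in>Z. l k * (cmod (e k (x n)))\<^sup>2)"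
      using F l by (intro sum_mono2 Z) (auto simp: less_imp_le)
    finally show "(\<Sum>k\<in>F. (cmod (of_real (l k) * cnj (e k (x n))))\<^sup>2 / l k) \<le> \<dots>" .
  qed (use l C in auto)
  then have "cmod (gram K (Suc n) x) * cmod (gram K (Suc n) x) \<le> cmod (gram K (Suc n) x) *
      (cmod (gram K n x) * (\<Sum>k\<in>Z. l k * (cmod (e k (x n)))\<^sup>2))"
    by (simp add: C(3) power2_eq_square mult_ac)
  moreover have "0 \<le> (\<Sum>k\<in>Z. l k * (cmod (e k (x n)))\<^sup>2)"
    using l by (intro sum_nonneg) (auto simp: less_imp_le subset_iff)
  ultimately show ?thesis
    by (cases "gram K (Suc n) x = 0") auto
qed

text \<open>Hadamard's inequality. The squared modulus of the determinant is the Gram determinant of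
  the columns, built up one column at a time; each column has squared length at most
  \<open>n\<close>.\<close>

lemma hadamard_unit_entries:
  fixes a :: "nat \<Rightarrow> nat \<Rightarrow> complex"
  assumes "\<And>i j. i < n \<Longrightarrow> j < n \<Longrightarrow> cmod (a i j) \<le> 1"
  shows "(cmod (Determinant.det (Matrix.mat n n (\<lambda>(i, j). a i j))))\<^sup>2 \<le> real n ^ n"
proof -
  define A where "A = Matrix.mat n n (\<lambda>(i, j). a i j)"
  define K where "K = (\<lambda>y z. \<Sum>k\<in>{0..<n}. of_real 1 * a k y * cnj (a k z))"
  have le: "cmod (gram K j (\<lambda>i. i)) \<le> real n ^ j" if "j \<le> n" for j
    using that
  proof (induction j)
    case (Suc j)
    have "cmod (gram K (Suc j) (\<lambda>i. i)) \<le> cmod (gram K j (\<lambda>i. i)) * (\<Sum>k\<in>{0..<n}. 1 * (cmod (a k j))\<^sup>2)"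
      unfolding K_def by (rule gram_Suc_le) auto
    also have "\<dots> \<le> real n ^ j * (\<Sum>k\<in>{0..<n}. 1)"
      using Suc assms by (intro mult_mono sum_mono) (auto intro!: power_le_one sum_nonneg)
    finally show ?case by (simp add: mult.commute)
  qed simp
  have A: "A \<in> carrier_mat n n" and B: "map_mat cnj A \<in> carrier_mat n n" by (auto simp: A_def)
  \<comment> \<open>The features are the rows and the points are the column indices, so this
    \<open>K\<close> holds the inner products of the columns.\<close>
  have eq: "transpose_mat A * map_mat cnj A = Matrix.mat n n (\<lambda>(i, j). K i j)"
    by (rule eq_matI) (auto simp: A_def K_def scalar_prod_def)
  have "Determinant.det (map_mat cnj A) = cnj (Determinant.det A)"
    unfolding det_def'[OF A] det_def'[OF B]
    using A by (auto intro!: sum.cong prod.cong simp: permutes_lessThan)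
  then have "gram K n (\<lambda>i. i) = Determinant.det A * cnj (Determinant.det A)"
    unfolding gram_def eq[symmetric] using A B
    by (subst det_mult[of _ n]) (auto simp: det_transpose[OF A])
  then have "cmod (gram K n (\<lambda>i. i)) = (cmod (Determinant.det A))\<^sup>2"
    by (simp add: norm_mult power2_eq_square)
  with le[of n] show ?thesis by (simp add: A_def)
qed

section \<open>Feature determinants and the Cauchy-Binet formula\<close>

definition edet :: "('k \<Rightarrow> 'x \<Rightarrow> complex) \<Rightarrow> nat \<Rightarrow> (nat \<Rightarrow> 'k) \<Rightarrow> (nat \<Rightarrow> 'x) \<Rightarrow> complex" where
  "edet e n f x = Determinant.det (Matrix.mat n n (\<lambda>(i, j). e (f i) (x j)))"

lemma edet_rows:
  "edet e n f x = (\<Sum>p | p permutes {0..<n}. of_int (sign p) * (\<Prod>i = 0..<n. e (f i) (x (p i))))"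
  unfolding edet_def by (subst det_def'[of _ n]) (auto intro!: sum.cong prod.cong simp: permutes_lessThan)

text \<open>Transposition moves the permutation from the points to the frequencies;
  \<open>gram_cauchy_binet\<close> uses both expansions.\<close>

lemma edet_cols:
  "edet e n f x = (\<Sum>p | p permutes {0..<n}. of_int (sign p) * (\<Prod>j = 0..<n. e (f (p j)) (x j)))"
proof -
  have "edet e n f x = Determinant.det (transpose_mat (Matrix.mat n n (\<lambda>(i, j). e (f i) (x j))))"
    unfolding edet_def by (subst det_transpose[of _ n]) auto
  also have "\<dots> = (\<Sum>p | p permutes {0..<n}. of_int (sign p) * (\<Prod>j = 0..<n. e (f (p j)) (x j)))"
    by (subst det_def'[of _ n]) (auto intro!: sum.cong prod.cong simp: permutes_lessThan)
  finally show ?thesis .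
qed

lemma edet_permute:
  assumes "p permutes {0..<n}"
  shows "edet e n (f \<circ> p) x = of_int (sign p) * edet e n f x"
proof -
  have "edet e n (f \<circ> p) x = Determinant.det (Matrix.mat n n (\<lambda>(i, j). Matrix.mat n n (\<lambda>(i, j). e (f i) (x j)) $$ (p i, j)))"
    unfolding edet_def by (intro arg_cong[where f = Determinant.det] eq_matI) (auto simp: permutes_lessThan[OF assms])
  also have "\<dots> = of_int (sign p) * edet e n f x"
    unfolding edet_def by (subst det_permute_rows[OF _ assms]) auto
  finally show ?thesis .
qed

lemma edet_not_inj:
  assumes "\<not> inj_on f {0..<n}"
  shows "edet e n f x = 0"
proof -
  from assms obtain i j where "i < n" "j < n" "i \<noteq> j" "f i = f j"
    by (auto simp: inj_on_def)
  then show ?thesis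
    unfolding edet_def by (intro det_identical_rows[of _ n i j]) (auto intro!: eq_vecI)
qed

text \<open>The inverse is composition with the inverse permutation. Since \<open>p\<close> fixes
  every point outside \<open>A\<close>, composition keeps maps extensional.\<close>

lemma bij_betw_comp_permutes:
  assumes "p permutes A"
  shows "bij_betw (\<lambda>f. f \<circ> p) (A \<rightarrow>\<^sub>E F) (A \<rightarrow>\<^sub>E F)"
proof -
  have *: "f \<circ> q \<in> A \<rightarrow>\<^sub>E F" if "q permutes A" "f \<in> A \<rightarrow>\<^sub>E F" for f q
    using that permutes_in_image[OF that(1)] permutes_not_in[OF that(1)] by (fastforce simp: PiE_iff extensional_def)
  show ?thesis
    by (rule bij_betw_byWitness[where f' = "\<lambda>f. f \<circ> Hilbert_Choice.inv p"])
      (use * permutes_inv[OF assms] assms in \<open>auto simp: comp_assoc permutes_inv_o\<close>)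
qed

text \<open>Cauchy-Binet summed over all maps instead of \<open>n\<close>-element sets:
  non-injective maps contribute zero and every set is met \<open>n!\<close> times, hence
  \<open>fact n\<close>. Expanding the kernel gives one determinant and one bare product; averaging
  over permutations of the frequencies turns the product into the second determinant.\<close>

lemma gram_cauchy_binet:
  fixes e :: "'k \<Rightarrow> 'x \<Rightarrow> complex" and l :: "'k \<Rightarrow> real"
  assumes F: "finite F"
  defines "K \<equiv> (\<lambda>y z. \<Sum>k\<in>F. of_real (l k) * e k y * cnj (e k z))"
  shows "fact n * gram K n x =
    of_real (\<Sum>f\<in>{0..<n} \<rightarrow>\<^sub>E F. (\<Prod>i = 0..<n. l (f i)) * (cmod (edet e n f x))\<^sup>2)"
proof -
  let ?P = "{p. p permutes {0..<n}}" and ?E = "{0..<n} \<rightarrow>\<^sub>E F"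
  let ?w = "\<lambda>f. complex_of_real (\<Prod>i = 0..<n. l (f i))"
  have "gram K n x = (\<Sum>p\<in>?P. of_int (sign p) *
      (\<Sum>f\<in>?E. \<Prod>i = 0..<n. of_real (l (f i)) * e (f i) (x i) * cnj (e (f i) (x (p i)))))"
    unfolding gram_permutes K_def using F by (subst prod_sum_PiE) auto
  also have "\<dots> = (\<Sum>f\<in>?E. \<Sum>p\<in>?P. of_int (sign p) *
      (\<Prod>i = 0..<n. of_real (l (f i)) * e (f i) (x i) * cnj (e (f i) (x (p i)))))"
    unfolding sum_distrib_left by (rule sum.swap)
  also have "\<dots> = (\<Sum>f\<in>?E. ?w f * (\<Prod>i = 0..<n. e (f i) (x i)) * cnj (edet e n f x))"
    by (simp add: edet_rows prod.distrib sum_distrib_left mult_ac)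
  finally have g: "gram K n x = (\<Sum>f\<in>?E. ?w f * (\<Prod>i = 0..<n. e (f i) (x i)) * cnj (edet e n f x))" .
  \<comment> \<open>Substituting \<open>f \<circ> q\<close> for \<open>f\<close> keeps the weight
    and multiplies the determinant by \<open>sign q\<close>.\<close>
  have gq: "gram K n x = (\<Sum>f\<in>?E. ?w f * cnj (edet e n f x) * (of_int (sign q) * (\<Prod>i = 0..<n. e (f (q i)) (x i))))"
    if q: "q permutes {0..<n}" for q
  proof -
    have wq: "(\<Prod>i = 0..<n. l (f (q i))) = (\<Prod>i = 0..<n. l (f i))" for f
      using prod.permute[OF q, of "\<lambda>i. l (f i)"] by (simp add: comp_def)
    have "gram K n x = (\<Sum>f\<in>?E. ?w (f \<circ> q) * (\<Prod>i = 0..<n. e ((f \<circ> q) i) (x i)) * cnj (edet e n (f \<circ> q) x))"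
      unfolding g by (rule sum.reindex_bij_betw[OF bij_betw_comp_permutes[OF q], symmetric])
    also have "\<dots> = (\<Sum>f\<in>?E. ?w f * (\<Prod>i = 0..<n. e (f (q i)) (x i)) * (of_int (sign q) * cnj (edet e n f x)))"
      by (intro sum.cong refl) (simp add: edet_permute[OF q] wq)
    finally show ?thesis by (simp add: mult_ac)
  qed
  have "fact n * gram K n x = (\<Sum>q\<in>?P. gram K n x)"
    by (simp add: card_permutations)
  also have "\<dots> = (\<Sum>q\<in>?P. \<Sum>f\<in>?E. ?w f * cnj (edet e n f x) * (of_int (sign q) * (\<Prod>i = 0..<n. e (f (q i)) (x i))))"
    using gq by (intro sum.cong) auto
  also have "\<dots> = (\<Sum>f\<in>?E. ?w f * cnj (edet e n f x) * edet e n f x)"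
    by (subst sum.swap) (simp add: edet_cols sum_distrib_left)
  also have "\<dots> = of_real (\<Sum>f\<in>?E. (\<Prod>i = 0..<n. l (f i)) * (cmod (edet e n f x))\<^sup>2)"
    unfolding of_real_sum of_real_mult complex_norm_square by (simp add: mult_ac)
  finally show ?thesis .
qed

text \<open>With both determinants expanded over permutations, the sum over the product grid
  factorises coordinatewise. Discrete orthogonality kills every pair \<open>p \<noteq> q\<close>,
  because the injective \<open>f\<close> then has different frequencies at some coordinate; the
  \<open>n!\<close> diagonal pairs contribute \<open>card X ^ n\<close> each.\<close>

lemma sum_edet_square_grid:
  fixes e :: "'k \<Rightarrow> 'x \<Rightarrow> complex"
  assumes X: "finite X"
    and orth: "\<And>k k'. k \<in> F \<Longrightarrow> k' \<in> F \<Longrightarrow> (\<Sum>y\<in>X. e k y * cnj (e k' y)) = (if k = k' then of_nat (card X) else 0)"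
    and f: "f \<in> {0..<n} \<rightarrow>\<^sub>E F" "inj_on f {0..<n}"
  shows "(\<Sum>x\<in>{0..<n} \<rightarrow>\<^sub>E X. (cmod (edet e n f x))\<^sup>2) = fact n * real (card X) ^ n"
proof -
  let ?P = "{p. p permutes {0..<n}}" and ?E = "{0..<n} \<rightarrow>\<^sub>E X"
  have "(\<Sum>x\<in>?E. edet e n f x * cnj (edet e n f x)) =
    (\<Sum>x\<in>?E. \<Sum>p\<in>?P. \<Sum>q\<in>?P. of_int (sign p) * of_int (sign q) * (\<Prod>j = 0..<n. e (f (p j)) (x j) * cnj (e (f (q j)) (x j))))"
    by (simp add: edet_cols sum_product prod.distrib mult_ac)
  also have "\<dots> = (\<Sum>p\<in>?P. \<Sum>x\<in>?E. \<Sum>q\<in>?P. of_int (sign p) * of_int (sign q) * (\<Prod>j = 0..<n. e (f (p j)) (x j) * cnj (e (f (q j)) (x j))))"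
    by (rule sum.swap)
  also have "\<dots> = (\<Sum>p\<in>?P. \<Sum>q\<in>?P. \<Sum>x\<in>?E. of_int (sign p) * of_int (sign q) * (\<Prod>j = 0..<n. e (f (p j)) (x j) * cnj (e (f (q j)) (x j))))"
    by (intro sum.cong refl sum.swap)
  also have "\<dots> = (\<Sum>p\<in>?P. \<Sum>q\<in>?P. of_int (sign p) * of_int (sign q) * (\<Prod>j = 0..<n. \<Sum>y\<in>X. e (f (p j)) y * cnj (e (f (q j)) y)))"
    using X by (subst prod_sum_PiE) (auto simp: sum_distrib_left)
  also have "\<dots> = (\<Sum>p\<in>?P. \<Sum>q\<in>?P. if p = q then of_nat (card X) ^ n else 0)"
  proof (intro sum.cong refl)
    fix p q assume p: "p \<in> ?P" and q: "q \<in> ?P"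
    have F: "f (p j) \<in> F" "f (q j) \<in> F" if "j < n" for j
      using f(1) p q permutes_lessThan that by (auto simp: PiE_iff)
    show "of_int (sign p) * of_int (sign q) * (\<Prod>j = 0..<n. \<Sum>y\<in>X. e (f (p j)) y * cnj (e (f (q j)) y)) =
        (if p = q then of_nat (card X) ^ n else (0::complex))"
    proof (cases "p = q")
      case True
      have "(\<Prod>j = 0..<n. \<Sum>y\<in>X. e (f (p j)) y * cnj (e (f (p j)) y)) = (\<Prod>j = 0..<n. of_nat (card X))"
        using F by (intro prod.cong refl) (simp add: orth)
      then show ?thesis using True by (simp flip: of_int_mult)
    next
      case False
      have "\<exists>j<n. p j \<noteq> q j"
      proof (rule ccontr)
        assume "\<not> ?thesis"
        then have "p j = q j" for j
          using p q permutes_not_in[of p "{0..<n}" j] permutes_not_in[of q "{0..<n}" j] by (cases "j < n") auto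
        with False show False by blast
      qed
      then obtain j where j: "j < n" "p j \<noteq> q j" by blast
      then have "f (p j) \<noteq> f (q j)"
        using f(2) p q permutes_lessThan[of _ n j] by (auto simp: inj_on_def)
      with j F have "(\<Prod>j = 0..<n. \<Sum>y\<in>X. e (f (p j)) y * cnj (e (f (q j)) y)) = 0"
        by (intro prod_zero) (auto simp: orth intro!: bexI[of _ j])
      with False show ?thesis by simp
    qed
  qed
  also have "\<dots> = of_real (fact n * real (card X) ^ n)"
    by (simp add: card_permutations finite_permutations)
  finally have "of_real (\<Sum>x\<in>?E. (cmod (edet e n f x))\<^sup>2) = complex_of_real (fact n * real (card X) ^ n)"
    unfolding of_real_sum complex_norm_square .
  then show ?thesis by (simp only: of_real_eq_iff)
qed

section \<open>Symmetric sums over injective maps\<close>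

text \<open>For \<open>card A = n\<close> this is \<open>n!\<close> times the \<open>n\<close>-th elementary symmetric sum of \<open>l\<close> over \<open>F\<close>.\<close>
definition inj_sum :: "('k \<Rightarrow> real) \<Rightarrow> 'k set \<Rightarrow> nat set \<Rightarrow> real" where
  "inj_sum l F A = (\<Sum>f | f \<in> A \<rightarrow>\<^sub>E F \<and> inj_on f A. \<Prod>i\<in>A. l (f i))"

text \<open>Transport along a bijection of the index sets. It brings the complement of a chosen
  index set, as it arises in \<open>inj_sum_double_le\<close>, back to an initial segment.\<close>

lemma inj_sum_cong_card:
  assumes "finite A" "finite B" "card A = card B"
  shows "inj_sum l F A = inj_sum l F B"
proof -
  from assms obtain b where b: "bij_betw b B A"
    by (metis finite_same_card_bij)
  define b' where "b' = inv_into B b"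
  have b': "bij_betw b' A B" using b unfolding b'_def by (rule bij_betw_inv_into)
  have bb': "\<And>i. i \<in> A \<Longrightarrow> b (b' i) = i" "\<And>i. i \<in> B \<Longrightarrow> b' (b i) = i"
    using b unfolding b'_def by (auto simp: bij_betw_inv_into_right bij_betw_inv_into_left)
  have in1: "\<And>i. i \<in> B \<Longrightarrow> b i \<in> A" and in2: "\<And>i. i \<in> A \<Longrightarrow> b' i \<in> B"
    using b b' bij_betwE by auto
  show ?thesis unfolding inj_sum_def
  proof (rule sum.reindex_bij_witness[of _ "\<lambda>g. restrict (g \<circ> b') A" "\<lambda>f. restrict (f \<circ> b) B"])
    fix f assume f: "f \<in> {f \<in> A \<rightarrow>\<^sub>E F. inj_on f A}"
    show "restrict (restrict (f \<circ> b) B \<circ> b') A = f"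
      using f by (auto simp: fun_eq_iff bb' in2 PiE_iff extensional_def)
    show "restrict (f \<circ> b) B \<in> {f \<in> B \<rightarrow>\<^sub>E F. inj_on f B}"
      using f in1 bb' by (auto simp: PiE_iff inj_on_def) metis
    show "(\<Prod>i\<in>B. l (restrict (f \<circ> b) B i)) = (\<Prod>i\<in>A. l (f i))"
      by (subst prod.reindex_bij_betw[OF b, symmetric]) (auto intro!: prod.cong)
  next
    fix f assume f: "f \<in> {f \<in> B \<rightarrow>\<^sub>E F. inj_on f B}"
    show "restrict (restrict (f \<circ> b') A \<circ> b) B = f"
      using f by (auto simp: fun_eq_iff bb' in1 PiE_iff extensional_def)
    show "restrict (f \<circ> b') A \<in> {f \<in> A \<rightarrow>\<^sub>E F. inj_on f A}"
      using f in2 bb' by (auto simp: PiE_iff inj_on_def) metis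
  qed
qed

text \<open>An injective map on \<open>2 * m\<close> indices takes at most \<open>m\<close> of them
  into \<open>J\<close>, so some \<open>m\<close> indices all map outside \<open>J\<close>. On
  these, injectivity is given up, which leaves a power of the tail sum; the other \<open>m\<close>
  indices still carry an injective map. There are at most \<open>2 ^ (2 * m)\<close> choices of the
  indices, whence \<open>4 ^ m\<close>.\<close>

lemma inj_sum_double_le:
  assumes l: "\<And>k. k \<in> F \<Longrightarrow> 0 \<le> l k" and F: "finite F" and J: "finite J" "card J \<le> m"
  shows "inj_sum l F {0..<2*m} \<le> 4 ^ m * inj_sum l F {0..<m} * (\<Sum>k\<in>F - J. l k) ^ m"
proof -
  define A where "A = {0..<2*m}"
  define S where "S = {f \<in> A \<rightarrow>\<^sub>E F. inj_on f A}"
  define w where "w B f = (\<Prod>i\<in>B. l (f i))" for B :: "nat set" and f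
  define \<I> where "\<I> = {I. I \<subseteq> A \<and> card I = m}"
  have A: "finite A" "card A = 2 * m" by (auto simp: A_def)
  have fE: "finite (B \<rightarrow>\<^sub>E F)" if "finite B" for B :: "nat set" using F that by (intro finite_PiE) auto
  have fS: "finite S" using fE[OF A(1)] by (rule rev_finite_subset) (auto simp: S_def)
  have fI: "finite \<I>" using A by (auto simp: \<I>_def)
  have w0: "0 \<le> w B f" if "f \<in> B \<rightarrow>\<^sub>E F" for B f
    using that l unfolding w_def by (intro prod_nonneg) auto
  have ex: "\<exists>I\<in>\<I>. f ` I \<subseteq> F - J" if f: "f \<in> S" for f
  proof -
    have "card {i\<in>A. f i \<in> J} = card (f ` {i\<in>A. f i \<in> J})"
      using f by (intro card_image[symmetric]) (auto simp: S_def inj_on_def)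
    also have "\<dots> \<le> card J" using J by (intro card_mono) auto
    finally have "card {i\<in>A. f i \<in> J} \<le> m" using J by simp
    moreover have "{i\<in>A. f i \<notin> J} = A - {i\<in>A. f i \<in> J}" by auto
    then have "card {i\<in>A. f i \<notin> J} = 2 * m - card {i\<in>A. f i \<in> J}"
      using A by (simp add: card_Diff_subset)
    ultimately have "m \<le> card {i\<in>A. f i \<notin> J}" by simp
    then obtain I where "I \<subseteq> {i\<in>A. f i \<notin> J}" "card I = m"
      by (meson obtain_subset_with_card_n)
    then show ?thesis using f by (intro bexI[of _ I]) (auto simp: S_def \<I>_def PiE_iff)
  qed
  have part: "(\<Sum>f\<in>{f\<in>S. f ` I \<subseteq> F - J}. w A f) \<le> inj_sum l F {0..<m} * (\<Sum>k\<in>F - J. l k) ^ m" if I: "I \<in> \<I>" for I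
  proof -
    have IA: "I \<subseteq> A" "card I = m" "finite I" using I A by (auto simp: \<I>_def intro: finite_subset)
    let ?P = "{f \<in> (A - I) \<rightarrow>\<^sub>E F. inj_on f (A - I)}" and ?Q = "I \<rightarrow>\<^sub>E (F - J)"
    have fP: "finite ?P" using fE[of "A - I"] A by (auto intro: rev_finite_subset)
    have fQ: "finite ?Q" using IA F by (intro finite_PiE) auto
    have "(\<Sum>f\<in>{f\<in>S. f ` I \<subseteq> F - J}. w A f) \<le> (\<Sum>gh\<in>?P \<times> ?Q. w (A - I) (fst gh) * w I (snd gh))"
    \<comment> \<open>Gluing a map on \<open>A - I\<close> with a map on \<open>I\<close> recovers
      \<open>f\<close>; pairs whose gluing is not injective only enlarge the right side.\<close>
    proof (rule sum_le_included[where i = "\<lambda>gh a. if a \<in> I then snd gh a else fst gh a"])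
      show "\<forall>gh\<in>?P \<times> ?Q. 0 \<le> w (A - I) (fst gh) * w I (snd gh)"
        by (auto intro!: mult_nonneg_nonneg w0)
      show "\<forall>f\<in>{f\<in>S. f ` I \<subseteq> F - J}. \<exists>gh\<in>?P \<times> ?Q. (\<lambda>a. if a \<in> I then snd gh a else fst gh a) = f \<and>
          w A f \<le> w (A - I) (fst gh) * w I (snd gh)"
      proof
        fix f assume f: "f \<in> {f\<in>S. f ` I \<subseteq> F - J}"
        have "w A f = w (A - I) f * w I f"
          unfolding w_def by (rule prod.subset_diff[OF IA(1) A(1)])
        also have "\<dots> = w (A - I) (restrict f (A - I)) * w I (restrict f I)"
          by (simp add: w_def)
        finally show "\<exists>gh\<in>?P \<times> ?Q. (\<lambda>a. if a \<in> I then snd gh a else fst gh a) = f \<and>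
          w A f \<le> w (A - I) (fst gh) * w I (snd gh)"
          using f IA
          by (intro bexI[of _ "(restrict f (A - I), restrict f I)"])
            (auto simp: S_def fun_eq_iff PiE_iff extensional_def inj_on_def restrict_def)
      qed
    qed (use fS fP fQ in auto)
    also have "\<dots> = (\<Sum>g\<in>?P. w (A - I) g) * (\<Sum>h\<in>?Q. w I h)"
      by (simp add: sum_product sum.cartesian_product case_prod_beta)
    also have "(\<Sum>h\<in>?Q. w I h) = (\<Sum>k\<in>F - J. l k) ^ m"
      unfolding w_def using IA F by (subst prod_sum_PiE[symmetric]) auto
    also have "(\<Sum>g\<in>?P. w (A - I) g) = inj_sum l F (A - I)"
      by (simp add: w_def inj_sum_def)
    also have "\<dots> = inj_sum l F {0..<m}"
      using IA A by (intro inj_sum_cong_card) (auto simp: card_Diff_subset)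
    finally show ?thesis .
  qed
  have "inj_sum l F A = (\<Sum>f\<in>S. w A f)" by (simp add: S_def w_def inj_sum_def)
  \<comment> \<open>Each \<open>f\<close> is charged to every admissible \<open>I\<close>, and at
    least one exists.\<close>
  also have "\<dots> \<le> (\<Sum>f\<in>S. \<Sum>I\<in>\<I>. if f ` I \<subseteq> F - J then w A f else 0)"
  proof (rule sum_mono)
    fix f assume f: "f \<in> S"
    then obtain I where I: "I \<in> \<I>" "f ` I \<subseteq> F - J" using ex by blast
    have "w A f = (if f ` I \<subseteq> F - J then w A f else 0)" using I by simp
    also have "\<dots> \<le> (\<Sum>I\<in>\<I>. if f ` I \<subseteq> F - J then w A f else 0)"
      using w0[of f A] f by (intro member_le_sum[OF I(1)] fI) (auto simp: S_def)
    finally show "w A f \<le> \<dots>" .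
  qed
  also have "\<dots> = (\<Sum>I\<in>\<I>. \<Sum>f\<in>{f\<in>S. f ` I \<subseteq> F - J}. w A f)"
    by (subst sum.swap) (simp add: sum.inter_filter fS)
  also have "\<dots> \<le> (\<Sum>I\<in>\<I>. inj_sum l F {0..<m} * (\<Sum>k\<in>F - J. l k) ^ m)"
    by (intro sum_mono part)
  also have "\<dots> = real (card \<I>) * (inj_sum l F {0..<m} * (\<Sum>k\<in>F - J. l k) ^ m)" by simp
  also have "\<dots> \<le> 4 ^ m * (inj_sum l F {0..<m} * (\<Sum>k\<in>F - J. l k) ^ m)"
  proof (rule mult_right_mono)
    have "card \<I> \<le> card (Pow A)" using A by (intro card_mono) (auto simp: \<I>_def)
    also have "\<dots> = 4 ^ m" using A by (simp add: card_Pow power_mult)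
    finally show "real (card \<I>) \<le> 4 ^ m" by (metis of_nat_le_iff of_nat_numeral of_nat_power)
    show "0 \<le> inj_sum l F {0..<m} * (\<Sum>k\<in>F - J. l k) ^ m"
      unfolding inj_sum_def using l
      by (intro mult_nonneg_nonneg sum_nonneg zero_le_power prod_nonneg) (auto simp: PiE_iff)
  qed
  finally show ?thesis by (simp add: A_def mult_ac)
qed

text \<open>\<open>n ^ n / n!\<close> is a single term of the exponential series at
  \<open>n\<close>.\<close>

lemma power_self_le_exp_fact: "real n ^ n \<le> exp (real n) * fact n"
proof -
  have "real n ^ n /\<^sub>R fact n \<le> exp (real n)"
    unfolding exp_def by (rule sum_le_suminf[OF summable_exp_generic, of "{n}", simplified]) auto
  then show ?thesis by (simp add: field_simps)
qed

section \<open>Nearly Fekete sampling points\<close>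

text \<open>An abstraction of the torus: \<open>Z\<close> stands for the frequencies,
  \<open>l\<close> for the inverse squared weights and \<open>e\<close> for the exponentials. The
  assumption \<open>grid\<close> provides, for finitely many frequencies, a finite point set on
  which averages behave like integrals of an orthonormal system.\<close>

locale weighted_features =
  fixes Z :: "'k set" and l :: "'k \<Rightarrow> real" and e :: "'k \<Rightarrow> 'x \<Rightarrow> complex" and T :: "'x set"
  assumes Z: "infinite Z"
    and l_pos: "k \<in> Z \<Longrightarrow> 0 < l k"
    and l_summable: "l summable_on Z"
    and e_le: "k \<in> Z \<Longrightarrow> y \<in> T \<Longrightarrow> cmod (e k y) \<le> 1"
    and grid: "finite F \<Longrightarrow> F \<subseteq> Z \<Longrightarrow> \<exists>X. finite X \<and> X \<noteq> {} \<and> X \<subseteq> T \<and>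
      (\<forall>k\<in>F. \<forall>k'\<in>F. (\<Sum>y\<in>X. e k y * cnj (e k' y)) = (if k = k' then of_nat (card X) else 0))"
begin

text \<open>\<open>K\<close> is the reproducing kernel and \<open>KF\<close> its truncation to
  finitely many frequencies, to which the finite Cauchy-Binet formula applies; statements on
  \<open>K\<close> follow by a limit.\<close>

definition K where "K y z = (\<Sum>\<^sub>\<infinity>k\<in>Z. of_real (l k) * e k y * cnj (e k z))"
definition KF where "KF F y z = (\<Sum>k\<in>F. of_real (l k) * e k y * cnj (e k z))"

lemma K_has_sum:
  assumes "y \<in> T" "z \<in> T"
  shows "((\<lambda>k. of_real (l k) * e k y * cnj (e k z)) has_sum K y z) Z"
proof -
  have "(\<lambda>k. norm (of_real (l k) * e k y * cnj (e k z))) summable_on Z"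
  proof (rule summable_on_comparison_test[OF l_summable])
    fix k assume k: "k \<in> Z"
    have "cmod (of_real (l k) * e k y * cnj (e k z)) = l k * (cmod (e k y) * cmod (e k z))"
      using l_pos[OF k] by (simp add: norm_mult)
    also have "\<dots> \<le> l k * (1 * 1)"
      using l_pos[OF k] e_le[OF k] assms by (intro mult_left_mono mult_mono) auto
    finally show "cmod (of_real (l k) * e k y * cnj (e k z)) \<le> l k" by simp
  qed simp
  then show ?thesis
    unfolding K_def by (intro has_sum_infsum) (rule abs_summable_summable)
qed

lemma gram_KF_tendsto:
  assumes "\<And>i. i < n \<Longrightarrow> x i \<in> T"
  shows "((\<lambda>F. gram (KF F) n x) \<longlongrightarrow> gram K n x) (finite_subsets_at_top Z)"
  unfolding gram_permutes
proof (intro tendsto_intros)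
  fix p i assume "p \<in> {p. p permutes {0..<n}}" "i \<in> {0..<n}"
  then show "((\<lambda>F. KF F (x i) (x (p i))) \<longlongrightarrow> K (x i) (x (p i))) (finite_subsets_at_top Z)"
    using K_has_sum[of "x i" "x (p i)"] assms permutes_lessThan unfolding KF_def has_sum_def by auto
qed

text \<open>By Cauchy-Binet the determinant is a nonnegative real, so the modulus changes
  nothing.\<close>

lemma norm_gram_KF:
  assumes F: "finite F" "F \<subseteq> Z"
  shows "fact n * cmod (gram (KF F) n x) =
    (\<Sum>f\<in>{0..<n} \<rightarrow>\<^sub>E F. (\<Prod>i = 0..<n. l (f i)) * (cmod (edet e n f x))\<^sup>2)" (is "_ = ?S")
proof -
  have "0 \<le> ?S"
    using F l_pos by (intro sum_nonneg mult_nonneg_nonneg prod_nonneg) (auto simp: PiE_iff less_imp_le subset_iff)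
  moreover have "cmod (fact n * gram (KF F) n x) = \<bar>?S\<bar>"
    unfolding KF_def gram_cauchy_binet[OF F(1)] norm_of_real ..
  ultimately show ?thesis by (simp add: norm_mult)
qed

text \<open>All Cauchy-Binet terms are nonnegative, and a larger frequency set only adds
  terms.\<close>

lemma norm_gram_KF_mono:
  assumes F: "finite F'" "F \<subseteq> F'" "F' \<subseteq> Z"
  shows "cmod (gram (KF F) n x) \<le> cmod (gram (KF F') n x)"
proof -
  have "finite F" "F \<subseteq> Z" using F finite_subset by auto
  then have "fact n * cmod (gram (KF F) n x) \<le> fact n * cmod (gram (KF F') n x)"
    unfolding norm_gram_KF[OF F(1,3)] norm_gram_KF[OF \<open>finite F\<close> \<open>F \<subseteq> Z\<close>]
    using F l_pos
    by (intro sum_mono2 finite_PiE PiE_mono mult_nonneg_nonneg prod_nonneg)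
      (auto simp: PiE_iff less_imp_le subset_iff)
  then show ?thesis by simp
qed

lemma norm_gram_KF_le_K:
  assumes F: "finite F" "F \<subseteq> Z" and x: "\<And>i. i < n \<Longrightarrow> x i \<in> T"
  shows "cmod (gram (KF F) n x) \<le> cmod (gram K n x)"
proof (rule tendsto_lowerbound[OF tendsto_norm[OF gram_KF_tendsto[OF x]]])
  show "\<forall>\<^sub>F G in finite_subsets_at_top Z. cmod (gram (KF F) n x) \<le> cmod (gram (KF G) n x)"
    using F unfolding eventually_finite_subsets_at_top by (intro exI[of _ F]) (auto intro: norm_gram_KF_mono)
qed auto

text \<open>Only injective maps survive in Cauchy-Binet, Hadamard bounds each squared determinant by
  \<open>n ^ n\<close>, and the factor \<open>fact n\<close> on the left reduces this to
  \<open>exp n\<close>.\<close>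

lemma norm_gram_KF_le:
  assumes F: "finite F" "F \<subseteq> Z" and x: "\<And>i. i < n \<Longrightarrow> x i \<in> T"
  shows "cmod (gram (KF F) n x) \<le> exp (real n) * inj_sum l F {0..<n}"
proof -
  let ?I = "{f. f \<in> {0..<n} \<rightarrow>\<^sub>E F \<and> inj_on f {0..<n}}"
  have fin: "finite ({0..<n} \<rightarrow>\<^sub>E F)" using F by (intro finite_PiE) auto
  have "fact n * cmod (gram (KF F) n x) = (\<Sum>f\<in>?I. (\<Prod>i = 0..<n. l (f i)) * (cmod (edet e n f x))\<^sup>2)"
    unfolding norm_gram_KF[OF F] by (rule sum.mono_neutral_right[OF fin]) (auto simp: edet_not_inj)
  also have "\<dots> \<le> (\<Sum>f\<in>?I. (\<Prod>i = 0..<n. l (f i)) * real n ^ n)"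
  proof (intro sum_mono mult_left_mono)
    fix f assume f: "f \<in> ?I"
    show "(cmod (edet e n f x))\<^sup>2 \<le> real n ^ n"
      unfolding edet_def using f F x e_le by (intro hadamard_unit_entries) (auto simp: PiE_iff subset_iff)
    show "0 \<le> (\<Prod>i = 0..<n. l (f i))"
      using f F l_pos by (intro prod_nonneg) (auto simp: PiE_iff less_imp_le subset_iff)
  qed
  also have "\<dots> = real n ^ n * inj_sum l F {0..<n}"
    by (simp add: inj_sum_def sum_distrib_left mult.commute)
  also have "\<dots> \<le> (exp (real n) * fact n) * inj_sum l F {0..<n}"
    using F l_pos unfolding inj_sum_def
    by (intro mult_right_mono power_self_le_exp_fact sum_nonneg prod_nonneg) (auto simp: PiE_iff less_imp_le subset_iff)
  finally show ?thesis by (simp add: mult_ac)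
qed

text \<open>By \<open>sum_edet_square_grid\<close> the average of the Gram determinant over all
  \<open>n\<close>-tuples of grid points equals \<open>inj_sum l F {0..<n}\<close>, so some tuple
  reaches it.\<close>

lemma exists_norm_gram_KF_ge:
  assumes F: "finite F" "F \<subseteq> Z"
  obtains x where "\<And>i. i < n \<Longrightarrow> x i \<in> T" "inj_sum l F {0..<n} \<le> cmod (gram (KF F) n x)"
proof -
  obtain X where X: "finite X" "X \<noteq> {}" "X \<subseteq> T"
    and orth: "\<And>k k'. k \<in> F \<Longrightarrow> k' \<in> F \<Longrightarrow> (\<Sum>y\<in>X. e k y * cnj (e k' y)) = (if k = k' then of_nat (card X) else 0)"
    using grid[OF F] by metis
  let ?I = "{f. f \<in> {0..<n} \<rightarrow>\<^sub>E F \<and> inj_on f {0..<n}}" and ?E = "{0..<n} \<rightarrow>\<^sub>E X"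
  have fin: "finite ({0..<n} \<rightarrow>\<^sub>E F)" using F by (intro finite_PiE) auto
  have finE: "finite ?E" using X by (intro finite_PiE) auto
  have neE: "?E \<noteq> {}" using X by (simp add: PiE_eq_empty_iff)
  have "(\<Sum>x\<in>?E. fact n * cmod (gram (KF F) n x)) =
      (\<Sum>x\<in>?E. \<Sum>f\<in>?I. (\<Prod>i = 0..<n. l (f i)) * (cmod (edet e n f x))\<^sup>2)"
    unfolding norm_gram_KF[OF F]
    by (intro sum.cong refl sum.mono_neutral_right[OF fin]) (auto simp: edet_not_inj)
  also have "\<dots> = (\<Sum>f\<in>?I. (\<Prod>i = 0..<n. l (f i)) * (\<Sum>x\<in>?E. (cmod (edet e n f x))\<^sup>2))"
    by (subst sum.swap) (simp add: sum_distrib_left)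
  also have "\<dots> = (\<Sum>f\<in>?I. (\<Prod>i = 0..<n. l (f i)) * (fact n * real (card X) ^ n))"
    using sum_edet_square_grid[OF X(1) orth] by (intro sum.cong refl) auto
  also have "\<dots> = fact n * (real (card X) ^ n * inj_sum l F {0..<n})"
    by (simp add: inj_sum_def sum_distrib_left mult_ac)
  finally have avg: "(\<Sum>x\<in>?E. cmod (gram (KF F) n x)) = real (card ?E) * inj_sum l F {0..<n}"
    using X by (simp add: sum_distrib_left[symmetric] card_PiE)
  have "\<exists>x\<in>?E. inj_sum l F {0..<n} \<le> cmod (gram (KF F) n x)"
  proof (rule ccontr)
    assume "\<not> ?thesis"
    then have "(\<Sum>x\<in>?E. cmod (gram (KF F) n x)) < (\<Sum>x\<in>?E. inj_sum l F {0..<n})"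
      using finE neE by (intro sum_strict_mono) auto
    with avg show False by simp
  qed
  then obtain x where "x \<in> ?E" "inj_sum l F {0..<n} \<le> cmod (gram (KF F) n x)" by blast
  with X show ?thesis by (intro that[of x]) (auto simp: PiE_iff subset_iff)
qed

lemma norm_gram_K_le:
  assumes x: "\<And>i. i < n \<Longrightarrow> x i \<in> T" and B: "\<And>F. finite F \<Longrightarrow> F \<subseteq> Z \<Longrightarrow> exp (real n) * inj_sum l F {0..<n} \<le> B"
  shows "cmod (gram K n x) \<le> B"
proof (rule tendsto_upperbound[OF tendsto_norm[OF gram_KF_tendsto[OF x]]])
  show "\<forall>\<^sub>F F in finite_subsets_at_top Z. cmod (gram (KF F) n x) \<le> B"
    using order_trans[OF norm_gram_KF_le B] x by (intro eventually_finite_subsets_at_top_weakI) auto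
qed auto

section \<open>Extremal Gram determinants\<close>

definition points where "points n = {x. \<forall>i<n::nat. x i \<in> T}"
text \<open>Maximisers would be Fekete points of the kernel; the proof works with
  near-maximisers.\<close>

definition D where "D n = (SUP x\<in>points n. cmod (gram K n x))"

text \<open>Dropping injectivity leaves the full power of a finite sum. The bound makes the supremum
  in \<open>D\<close> finite.\<close>

lemma inj_sum_le_power:
  assumes F: "finite F" "F \<subseteq> Z"
  shows "inj_sum l F {0..<n} \<le> (infsum l Z) ^ n"
proof -
  have fin: "finite ({0..<n} \<rightarrow>\<^sub>E F)" using F by (intro finite_PiE) auto
  have "inj_sum l F {0..<n} \<le> (\<Sum>f\<in>{0..<n} \<rightarrow>\<^sub>E F. \<Prod>i = 0..<n. l (f i))"
    unfolding inj_sum_def using F l_pos fin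
    by (intro sum_mono2 prod_nonneg) (auto simp: PiE_iff less_imp_le subset_iff)
  also have "\<dots> = (\<Sum>k\<in>F. l k) ^ n" using F by (subst prod_sum_PiE[symmetric]) auto
  also have "\<dots> \<le> (infsum l Z) ^ n"
    using F l_pos by (intro power_mono finite_sum_le_infsum l_summable sum_nonneg) (auto simp: less_imp_le subset_iff)
  finally show ?thesis .
qed

lemma norm_gram_K_le_D:
  assumes "x \<in> points n"
  shows "cmod (gram K n x) \<le> D n"
  unfolding D_def
proof (rule cSUP_upper[OF assms])
  show "bdd_above ((\<lambda>x. cmod (gram K n x)) ` points n)"
    by (rule bdd_aboveI2[where M = "exp (real n) * infsum l Z ^ n"], rule norm_gram_K_le)
      (auto simp: points_def intro!: mult_left_mono inj_sum_le_power)
qed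

lemma inj_sum_le_D:
  assumes F: "finite F" "F \<subseteq> Z"
  shows "inj_sum l F {0..<n} \<le> D n"
proof -
  obtain x where x: "\<And>i. i < n \<Longrightarrow> x i \<in> T" "inj_sum l F {0..<n} \<le> cmod (gram (KF F) n x)"
    using exists_norm_gram_KF_ge[OF F] by blast
  note x(2)
  also have "\<dots> \<le> cmod (gram K n x)" using F x(1) by (rule norm_gram_KF_le_K)
  also have "\<dots> \<le> D n" using x(1) by (intro norm_gram_K_le_D) (auto simp: points_def)
  finally show ?thesis .
qed

lemma points_nonempty: "points n \<noteq> {}"
proof -
  obtain X where "X \<noteq> {}" "X \<subseteq> T" using grid[of "{}"] by auto
  then obtain y where "y \<in> T" by blast
  then have "(\<lambda>_. y) \<in> points n" by (simp add: points_def)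
  then show ?thesis by blast
qed

text \<open>As \<open>Z\<close> is infinite, \<open>n\<close> distinct frequencies exist and give a
  positive term of a symmetric sum below \<open>D n\<close>. Positivity makes the ratios of
  consecutive values meaningful.\<close>

lemma D_pos: "0 < D n"
proof -
  obtain F where F: "finite F" "F \<subseteq> Z" "card F = n"
    using infinite_arbitrarily_large[OF Z] by blast
  obtain b where b: "bij_betw b {0..<n} F"
    using ex_bij_betw_nat_finite[OF F(1)] F(3) by auto
  let ?I = "{f. f \<in> {0..<n} \<rightarrow>\<^sub>E F \<and> inj_on f {0..<n}}"
  have "restrict b {0..<n} \<in> ?I"
    using b by (auto simp: bij_betw_def inj_on_def)
  then have "?I \<noteq> {}" by blast
  moreover have "finite ?I" using F finite_PiE[of "{0..<n}" "\<lambda>_. F"] by auto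
  moreover have "0 < (\<Prod>i = 0..<n. l (f i))" if "f \<in> ?I" for f
    using that F l_pos by (intro prod_pos) (auto simp: PiE_iff subset_iff)
  ultimately have "0 < inj_sum l F {0..<n}"
    unfolding inj_sum_def by (intro sum_pos) simp_all
  then show ?thesis using inj_sum_le_D[OF F(1,2)] by (rule less_le_trans)
qed

text \<open>Symmetric sums link the two orders: Hadamard's bound from above at order
  \<open>2 * m\<close>, the splitting off of \<open>m\<close> factors outside \<open>J\<close>, and
  the grid average from below at order \<open>m\<close>. The 4 comes from the splitting,
  \<open>(exp 1)\<^sup>2\<close> from Hadamard's bound at order \<open>2 * m\<close>.\<close>

lemma D_double_le:
  assumes J: "finite J" "card J \<le> m" and t: "\<And>F. finite F \<Longrightarrow> F \<subseteq> Z - J \<Longrightarrow> sum l F \<le> t"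
  shows "D (2 * m) \<le> (4 * (exp 1)\<^sup>2 * t) ^ m * D m"
  unfolding D_def[of "2 * m"]
proof (rule cSUP_least[OF points_nonempty], rule norm_gram_K_le)
  have t0: "0 \<le> t" using t[of "{}"] by simp
  fix F assume F: "finite F" "F \<subseteq> Z"
  have l0: "\<And>k. k \<in> F \<Longrightarrow> 0 \<le> l k" using l_pos F by (auto simp: less_imp_le subset_iff)
  have "inj_sum l F {0..<2*m} \<le> 4 ^ m * inj_sum l F {0..<m} * (\<Sum>k\<in>F - J. l k) ^ m"
    using l0 F J by (intro inj_sum_double_le) auto
  also have "\<dots> \<le> 4 ^ m * D m * t ^ m"
  proof (intro mult_mono power_mono inj_sum_le_D F)
    show "sum l (F - J) \<le> t" using F by (intro t) auto
    show "0 \<le> (\<Sum>k\<in>F - J. l k)" using l0 by (intro sum_nonneg) auto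
    then show "0 \<le> (\<Sum>k\<in>F - J. l k) ^ m" by simp
    show "0 \<le> inj_sum l F {0..<m}"
      unfolding inj_sum_def using l0 by (intro sum_nonneg prod_nonneg) (auto simp: PiE_iff)
  qed (use D_pos[of m] in auto)
  finally have le: "inj_sum l F {0..<2*m} \<le> 4 ^ m * D m * t ^ m" .
  have "exp (real (2 * m)) = ((exp 1)\<^sup>2) ^ m"
    by (simp flip: exp_of_nat_mult power_mult)
  then have "exp (real (2 * m)) * inj_sum l F {0..<2*m} \<le> ((exp 1)\<^sup>2) ^ m * (4 ^ m * D m * t ^ m)"
    using le by (simp only: mult_left_mono zero_le_power zero_le_power2)
  also have "\<dots> = (4 * (exp 1)\<^sup>2 * t) ^ m * D m"
    by (simp add: power_mult_distrib mult_ac)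
  finally show "exp (real (2 * m)) * inj_sum l F {0..<2*m} \<le> (4 * (exp 1)\<^sup>2 * t) ^ m * D m" .
qed (auto simp: points_def)

text \<open>The \<open>m\<close> ratios \<open>D (Suc n) / D n\<close> between \<open>D m\<close>
  and \<open>D (2 * m)\<close> multiply to at most \<open>q ^ m\<close>, so one of them is at most
  \<open>q\<close>. For points with determinant above half of \<open>D n\<close>,
  \<open>gram_power_function\<close> with \<open>y\<close> as an additional point gives the bound.
  Here \<open>c\<close> holds the coefficients of a function \<open>h\<close> of squared norm at
  most \<open>M\<close>.\<close>

theorem sampling_points:
  assumes J: "finite J" "card J \<le> m" and m: "1 \<le> m"
    and t: "\<And>F. finite F \<Longrightarrow> F \<subseteq> Z - J \<Longrightarrow> sum l F \<le> t"
  obtains n x where "n < 2 * m" "\<forall>i<n. x i \<in> T"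
    "\<forall>c h M y. (\<forall>F. finite F \<longrightarrow> F \<subseteq> Z \<longrightarrow> (\<Sum>k\<in>F. (cmod (c k))\<^sup>2 / l k) \<le> M) \<longrightarrow>
      (\<forall>y\<in>T. ((\<lambda>k. c k * e k y) has_sum h y) Z) \<longrightarrow>
      (\<forall>i<n. h (x i) = 0) \<longrightarrow> y \<in> T \<longrightarrow> (cmod (h y))\<^sup>2 \<le> 64 * t * M"
proof -
  \<comment> \<open>\<open>q ^ m\<close> is the factor in \<open>D_double_le\<close>.\<close>
  define q where "q = 4 * (exp 1)\<^sup>2 * t"
  have t0: "0 \<le> t" using t[of "{}"] by simp
  then have q0: "0 \<le> q" by (simp add: q_def)
  have "\<exists>n. m \<le> n \<and> n < 2 * m \<and> D (Suc n) \<le> q * D n"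
  proof (rule ccontr)
    assume "\<not> ?thesis"
    then have step: "q * D n < D (Suc n)" if "m \<le> n" "n < 2 * m" for n
      using that by force
    have "q ^ Suc j * D m < D (m + Suc j)" if "Suc j \<le> m" for j
      using that
    proof (induction j)
      case 0
      then show ?case using step[of m] m by simp
    next
      case (Suc j)
      have "q ^ Suc (Suc j) * D m = q * (q ^ Suc j * D m)" by simp
      also have "\<dots> \<le> q * D (m + Suc j)" using Suc q0 by (intro mult_left_mono) auto
      also have "\<dots> < D (m + Suc (Suc j))" using step[of "m + Suc j"] Suc.prems by simp
      finally show ?case .
    qed
    from this[of "m - 1"] have "q ^ m * D m < D (2 * m)" using m by (simp add: mult_2)
    with D_double_le[OF J t] show False by (simp add: q_def)
  qed
  then obtain n where n: "m \<le> n" "n < 2 * m" "D (Suc n) \<le> q * D n" by blast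
  \<comment> \<open>Since \<open>D n\<close> is positive, half of it lies strictly below the
    supremum; this costs a factor 2.\<close>
  have "\<exists>x\<in>points n. D n / 2 < cmod (gram K n x)"
  proof (rule ccontr)
    assume "\<not> ?thesis"
    then have "D n \<le> D n / 2"
      by (subst D_def, intro cSUP_least points_nonempty) (auto simp: not_less)
    with D_pos[of n] show False by simp
  qed
  then obtain x where x: "x \<in> points n" "D n / 2 < cmod (gram K n x)" by blast
  show thesis
  proof (rule that[OF n(2), of x], goal_cases)
    case 1
    show ?case using x(1) by (simp add: points_def)
  next
    case 2
    show ?case
    proof (intro allI impI)
      fix c h M y
      assume "\<forall>F. finite F \<longrightarrow> F \<subseteq> Z \<longrightarrow> (\<Sum>k\<in>F. (cmod (c k))\<^sup>2 / l k) \<le> M"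
        and "\<forall>y\<in>T. ((\<lambda>k. c k * e k y) has_sum h y) Z"
        and "\<forall>i<n. h (x i) = 0" and y: "y \<in> T"
      then have c: "\<And>F. finite F \<Longrightarrow> F \<subseteq> Z \<Longrightarrow> (\<Sum>k\<in>F. (cmod (c k))\<^sup>2 / l k) \<le> M"
        and h: "\<And>y. y \<in> T \<Longrightarrow> ((\<lambda>k. c k * e k y) has_sum h y) Z"
        and 0: "\<And>i. i < n \<Longrightarrow> h (x i) = 0" by blast+
      \<comment> \<open>The test point takes position \<open>n\<close>; the first \<open>n\<close>
        points and their determinant stay unchanged.\<close>
      define x' where "x' = x(n := y)"
      have x'T: "x' i \<in> T" if "i \<le> n" for i using x(1) y that by (auto simp: points_def x'_def)
      have M: "0 \<le> M" using c[of "{}"] by simp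
      have g: "gram K n x' = gram K n x"
        unfolding gram_def by (intro arg_cong[where f = Determinant.det] eq_matI) (auto simp: x'_def)
      have "(cmod (h (x' n)))\<^sup>2 * cmod (gram K n x') \<le> M * cmod (gram K (Suc n) x')"
      proof (rule gram_power_function[where Z = Z and l = l and e = e and c = c and h = "\<lambda>i. h (x' i)"])
        show "h (x' i) = 0" if "i < n" for i using 0[OF that] that by (simp add: x'_def)
      qed (use l_pos K_has_sum x'T c h in auto)
      also have "\<dots> \<le> M * (q * D n)"
        using x'T by (intro mult_left_mono M order_trans[OF norm_gram_K_le_D n(3)]) (auto simp: points_def)
      also have "\<dots> \<le> M * (q * (2 * cmod (gram K n x)))"
        using x(2) q0 M by (intro mult_left_mono) auto
      finally have "(cmod (h (x' n)))\<^sup>2 * cmod (gram K n x) \<le> (2 * M * q) * cmod (gram K n x)"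
        unfolding g by (simp only: mult_ac)
      moreover have "x' n = y" by (simp add: x'_def)
      moreover have "0 < cmod (gram K n x)" using x(2) D_pos[of n] by linarith
      ultimately have "(cmod (h y))\<^sup>2 \<le> 2 * M * q" by simp
      also have "\<dots> = 8 * (exp 1)\<^sup>2 * (t * M)" by (simp add: q_def)
      \<comment> \<open>\<open>exp 1\<close> is below 2.75, whose square is less than 8. The value
        64 is a convenient square for the later root.\<close>
      also have "\<dots> \<le> 64 * (t * M)"
      proof (rule mult_right_mono)
        have "(exp 1)\<^sup>2 \<le> (2.75::real)\<^sup>2" using e_less_272 by (intro power_mono) auto
        then show "8 * (exp 1)\<^sup>2 \<le> (64::real)" by (simp add: power2_eq_square)
      qed (use t0 M in simp)
      finally show "(cmod (h y))\<^sup>2 \<le> 64 * t * M" by simp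
    qed
  qed
qed

end

section \<open>A trace bound for arbitrary linear information\<close>

definition ip :: "'k set \<Rightarrow> ('k \<Rightarrow> complex) \<Rightarrow> ('k \<Rightarrow> complex) \<Rightarrow> complex" where
  "ip F x y = (\<Sum>k\<in>F. x k * cnj (y k))"

lemma ip_self: "ip F x x = of_real (\<Sum>k\<in>F. (cmod (x k))\<^sup>2)"
  unfolding ip_def of_real_sum complex_norm_square ..

lemma ip_self_Re: "(\<Sum>k\<in>F. (cmod (x k))\<^sup>2) = Re (ip F x x)"
  by (simp add: ip_self)

lemma ip_cnj: "cnj (ip F x y) = ip F y x"
  by (simp add: ip_def mult.commute)

lemma ip_diff_left: "ip F (\<lambda>k. x k - y k) z = ip F x z - ip F y z"
  by (simp add: ip_def algebra_simps sum_subtractf)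

lemma ip_diff_right: "ip F x (\<lambda>k. y k - z k) = ip F x y - ip F x z"
  by (simp add: ip_def algebra_simps sum_subtractf)

lemma ip_lincomb_left: "ip F (\<lambda>k. \<Sum>s<r. b s * q s k) z = (\<Sum>s<r. b s * ip F (q s) z)" for r :: nat
  unfolding ip_def by (subst sum_distrib_left, subst sum.swap) (simp add: sum_distrib_left sum_distrib_right mult_ac)

lemma ip_lincomb_right: "ip F z (\<lambda>k. \<Sum>s<r. b s * q s k) = (\<Sum>s<r. cnj (b s) * ip F z (q s))" for r :: nat
  using arg_cong[OF ip_lincomb_left[where F = F and r = r and b = b and q = q and z = z], of cnj] by (simp add: ip_cnj)

definition orthonormal :: "'k set \<Rightarrow> nat \<Rightarrow> (nat \<Rightarrow> 'k \<Rightarrow> complex) \<Rightarrow> bool" where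
  "orthonormal F r q \<longleftrightarrow> (\<forall>s<r. \<forall>t<r. ip F (q s) (q t) = (if s = t then 1 else 0))"

text \<open>For an orthonormal family \<open>q\<close> this is \<open>x\<close> minus its orthogonal
  projection onto the span.\<close>

definition residual :: "'k set \<Rightarrow> nat \<Rightarrow> (nat \<Rightarrow> 'k \<Rightarrow> complex) \<Rightarrow> ('k \<Rightarrow> complex) \<Rightarrow> 'k \<Rightarrow> complex" where
  "residual F r q x = (\<lambda>k. x k - (\<Sum>s<r. ip F x (q s) * q s k))"

lemma ip_residual_basis:
  assumes "orthonormal F r q" "t < r"
  shows "ip F (residual F r q x) (q t) = 0"
proof -
  have "(\<Sum>s<r. ip F x (q s) * ip F (q s) (q t)) = (\<Sum>s<r. if s = t then ip F x (q t) else 0)"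
    using assms by (intro sum.cong) (auto simp: orthonormal_def)
  then show ?thesis
    using assms(2) by (simp add: residual_def ip_diff_left ip_lincomb_left)
qed

lemma ip_residual_right:
  assumes "\<And>s. s < r \<Longrightarrow> ip F a (q s) = 0"
  shows "ip F a (residual F r q x) = ip F a x"
  using assms by (simp add: residual_def ip_diff_right ip_lincomb_right)

lemma ip_residual_self:
  assumes "orthonormal F r q"
  shows "ip F (residual F r q x) x = of_real ((\<Sum>k\<in>F. (cmod (x k))\<^sup>2) - (\<Sum>s<r. (cmod (ip F x (q s)))\<^sup>2))"
proof -
  have "ip F (residual F r q x) x = ip F x x - (\<Sum>s<r. ip F x (q s) * cnj (ip F x (q s)))"
    by (simp add: residual_def ip_diff_left ip_lincomb_left ip_cnj)
  then show ?thesis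
    by (simp add: ip_self complex_norm_square[symmetric] del: of_real_power)
qed

text \<open>Pythagoras: the residual is orthogonal to the family, so its product with itself equals
  its product with \<open>x\<close>. Nonnegativity of the left side is Bessel's inequality.\<close>

lemma norm_residual:
  assumes "orthonormal F r q"
  shows "(\<Sum>k\<in>F. (cmod (residual F r q x k))\<^sup>2) = (\<Sum>k\<in>F. (cmod (x k))\<^sup>2) - (\<Sum>s<r. (cmod (ip F x (q s)))\<^sup>2)"
proof -
  have "ip F (residual F r q x) (residual F r q x) = ip F (residual F r q x) x"
    by (rule ip_residual_right) (rule ip_residual_basis[OF assms])
  then show ?thesis by (simp add: ip_self_Re[where x = "residual F r q x"] ip_residual_self[OF assms])
qed

text \<open>Gram-Schmidt, recorded only through annihilators. A vector whose residual vanishes on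
  \<open>F\<close> leaves the family as it is, hence \<open>r \<le> n\<close>; otherwise the
  normalised residual is appended.\<close>

lemma gram_schmidt_annihilator:
  fixes v :: "nat \<Rightarrow> 'k \<Rightarrow> complex"
  assumes F: "finite F"
  obtains r q where "r \<le> n" "orthonormal F r q"
    "\<And>a i. (\<And>s. s < r \<Longrightarrow> ip F a (q s) = 0) \<Longrightarrow> i < n \<Longrightarrow> ip F a (v i) = 0"
proof (induction n arbitrary: thesis)
  case 0
  show ?case by (rule 0[of 0]) (auto simp: orthonormal_def)
next
  case (Suc n)
  obtain r q where q: "r \<le> n" "orthonormal F r q"
    "\<And>a i. (\<And>s. s < r \<Longrightarrow> ip F a (q s) = 0) \<Longrightarrow> i < n \<Longrightarrow> ip F a (v i) = 0"
    by (rule Suc.IH) blast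
  define w where "w = residual F r q (v n)"
  define S where "S = (\<Sum>k\<in>F. (cmod (w k))\<^sup>2)"
  have wq: "ip F w (q s) = 0" if "s < r" for s
    unfolding w_def using q(2) that by (rule ip_residual_basis)
  have av: "ip F a (v n) = ip F a w" if "\<And>s. s < r \<Longrightarrow> ip F a (q s) = 0" for a
    unfolding w_def using ip_residual_right[OF that] by simp
  show ?case
  proof (cases "S = 0")
    case True
    then have "w k = 0" if "k \<in> F" for k
      using that F by (simp add: S_def sum_nonneg_eq_0_iff)
    then have "ip F a w = 0" for a by (simp add: ip_def)
    then show ?thesis
      by (intro Suc.prems[of r q]) (use q av in \<open>auto simp: less_Suc_eq\<close>)
  next
    case False
    moreover have "0 \<le> S" by (simp add: S_def sum_nonneg)
    ultimately have S: "0 < S" by simp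
    define q' where "q' = q(r := \<lambda>k. w k / of_real (sqrt S))"
    have ipr: "ip F a (q' r) = ip F a w / of_real (sqrt S)" for a
      by (simp add: q'_def ip_def sum_divide_distrib)
    have ipl: "ip F (q' r) a = ip F w a / of_real (sqrt S)" for a
      by (simp add: q'_def ip_def sum_divide_distrib)
    have q's: "q' s = q s" if "s < r" for s using that by (simp add: q'_def)
    have "ip F w w = of_real S" by (simp add: ip_self S_def)
    then have rr: "ip F (q' r) (q' r) = 1"
      using S by (simp add: ipr ipl flip: of_real_mult)
    have rs: "ip F (q' r) (q s) = 0" "ip F (q s) (q' r) = 0" if "s < r" for s
    proof -
      show "ip F (q' r) (q s) = 0" by (simp add: ipl wq[OF that])
      then show "ip F (q s) (q' r) = 0" using ip_cnj[of F "q' r" "q s"] by simp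
    qed
    show ?thesis
    proof (rule Suc.prems[of "Suc r" q'])
      show "Suc r \<le> Suc n" using q by simp
      show "orthonormal F (Suc r) q'"
        using q(2) rr rs unfolding orthonormal_def by (auto simp: less_Suc_eq q's)
      fix a i assume a: "\<And>s. s < Suc r \<Longrightarrow> ip F a (q' s) = 0" and i: "i < Suc n"
      have aq: "ip F a (q s) = 0" if "s < r" for s using a[of s] that by (simp add: q's)
      have "ip F a w = 0" using a[of r] S by (simp add: ipr)
      then show "ip F a (v i) = 0"
        using q(3)[of a i] aq av[of a] i by (cases "i = n") auto
    qed
  qed
qed

text \<open>The \<open>v i\<close> represent linear information in coefficient coordinates. At each
  grid point \<open>y\<close>, the normalised residual of the kernel section has zero information,
  so its value at \<open>y\<close> is bounded by \<open>E\<close>. Averaging over the grid yields a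
  trace inequality, in which a projection of rank at most \<open>card J\<close> captures no more
  than the weights in \<open>J\<close>, the largest ones.\<close>

lemma trace_lower_bound:
  fixes e :: "'k \<Rightarrow> 'x \<Rightarrow> complex" and v :: "nat \<Rightarrow> 'k \<Rightarrow> complex"
  assumes F: "finite F" "J \<subseteq> F" "n \<le> card J"
    and l: "\<And>k. k \<in> F \<Longrightarrow> 0 \<le> l k"
    and J: "\<And>k k'. k \<in> J \<Longrightarrow> k' \<in> F - J \<Longrightarrow> l k' \<le> l k"
    and X: "finite X" "X \<noteq> {}"
    and orth: "\<And>k k'. k \<in> F \<Longrightarrow> k' \<in> F \<Longrightarrow> (\<Sum>y\<in>X. e k y * cnj (e k' y)) = (if k = k' then of_nat (card X) else 0)"
    and e1: "\<And>k y. k \<in> F \<Longrightarrow> y \<in> X \<Longrightarrow> cmod (e k y) = 1"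
    and E: "\<And>a y. (\<And>i. i < n \<Longrightarrow> ip F a (v i) = 0) \<Longrightarrow> (\<Sum>k\<in>F. (cmod (a k))\<^sup>2) \<le> 1 \<Longrightarrow> y \<in> X \<Longrightarrow>
      cmod (\<Sum>k\<in>F. a k * (of_real (sqrt (l k)) * e k y)) \<le> E"
  shows "(\<Sum>k\<in>F - J. l k) \<le> E\<^sup>2"
proof -
  obtain r q where q: "r \<le> n" "orthonormal F r q"
    and ann: "\<And>a i. (\<And>s. s < r \<Longrightarrow> ip F a (q s) = 0) \<Longrightarrow> i < n \<Longrightarrow> ip F a (v i) = 0"
    using gram_schmidt_annihilator[OF F(1)] by blast
  \<comment> \<open>\<open>\<kappa> y\<close> is the kernel section at \<open>y\<close> in
    coordinates with respect to the functions \<open>sqrt (l k) * e k\<close>; \<open>t k\<close> is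
    a diagonal entry of the projection onto the span of the \<open>q s\<close>.\<close>
  define \<kappa> where "\<kappa> y = (\<lambda>k. of_real (sqrt (l k)) * cnj (e k y))" for y
  define t where "t k = (\<Sum>s<r. (cmod (q s k))\<^sup>2)" for k
  have pointwise: "(\<Sum>k\<in>F. l k) - (\<Sum>s<r. (cmod (ip F (\<kappa> y) (q s)))\<^sup>2) \<le> E\<^sup>2" if y: "y \<in> X" for y
  proof -
    define u where "u = residual F r q (\<kappa> y)"
    \<comment> \<open>\<open>N\<close> is the squared norm of the residual and also its value at
      \<open>y\<close>, so the normalised residual has value \<open>sqrt N\<close> there.\<close>
    define N where "N = (\<Sum>k\<in>F. l k) - (\<Sum>s<r. (cmod (ip F (\<kappa> y) (q s)))\<^sup>2)"
    have "(\<Sum>k\<in>F. (cmod (\<kappa> y k))\<^sup>2) = (\<Sum>k\<in>F. l k)"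
      using l e1 y by (intro sum.cong) (auto simp: \<kappa>_def norm_mult power_mult_distrib)
    then have N1: "(\<Sum>k\<in>F. (cmod (u k))\<^sup>2) = N" and N2: "ip F u (\<kappa> y) = of_real N"
      unfolding u_def N_def norm_residual[OF q(2)] ip_residual_self[OF q(2)] by simp_all
    have uq: "ip F u (q s) = 0" if "s < r" for s unfolding u_def using q(2) that by (rule ip_residual_basis)
    show ?thesis
    proof (cases "0 < N")
      case False
      then show ?thesis unfolding N_def[symmetric] by (smt (verit) zero_le_power2)
    next
      case True
      define a where "a k = u k / of_real (sqrt N)" for k
      have "ip F a (v i) = 0" if "i < n" for i
        by (rule ann[OF _ that]) (simp add: a_def ip_def sum_divide_distrib[symmetric] uq[unfolded ip_def])
      moreover have "(\<Sum>k\<in>F. (cmod (a k))\<^sup>2) \<le> 1"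
        using True N1 by (simp add: a_def norm_divide power_divide sum_divide_distrib[symmetric])
      ultimately have "cmod (\<Sum>k\<in>F. a k * (of_real (sqrt (l k)) * e k y)) \<le> E"
        using y by (rule E)
      moreover have "(\<Sum>k\<in>F. a k * (of_real (sqrt (l k)) * e k y)) = ip F u (\<kappa> y) / of_real (sqrt N)"
        by (simp add: a_def ip_def \<kappa>_def sum_divide_distrib)
      moreover have "cmod (ip F u (\<kappa> y) / of_real (sqrt N)) = sqrt N"
        unfolding N2 using True by (simp add: norm_divide real_div_sqrt)
      ultimately have "sqrt N \<le> E" by simp
      then have "(sqrt N)\<^sup>2 \<le> E\<^sup>2" using True by (intro power_mono) auto
      then show ?thesis using True by (simp add: N_def)
    qed
  qed
  \<comment> \<open>Orthogonality on the grid removes the mixed terms.\<close>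
  have avg: "(\<Sum>y\<in>X. (cmod (ip F (\<kappa> y) (q s)))\<^sup>2) = real (card X) * (\<Sum>k\<in>F. l k * (cmod (q s k))\<^sup>2)" for s
  proof -
    let ?g = "\<lambda>k. of_real (sqrt (l k)) * cnj (q s k)"
    have "(\<Sum>y\<in>X. ip F (\<kappa> y) (q s) * cnj (ip F (\<kappa> y) (q s))) =
        (\<Sum>y\<in>X. \<Sum>k\<in>F. \<Sum>k'\<in>F. ?g k * cnj (?g k') * (e k' y * cnj (e k y)))"
      unfolding ip_def \<kappa>_def
      by (intro sum.cong refl) (simp add: sum_product mult_ac, subst sum.swap, simp add: mult_ac)
    also have "\<dots> = (\<Sum>k\<in>F. \<Sum>y\<in>X. \<Sum>k'\<in>F. ?g k * cnj (?g k') * (e k' y * cnj (e k y)))"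
      by (rule sum.swap)
    also have "\<dots> = (\<Sum>k\<in>F. \<Sum>k'\<in>F. ?g k * cnj (?g k') * (\<Sum>y\<in>X. e k' y * cnj (e k y)))"
      unfolding sum_distrib_left by (intro sum.cong refl sum.swap)
    also have "\<dots> = (\<Sum>k\<in>F. \<Sum>k'\<in>F. if k' = k then ?g k * cnj (?g k) * of_nat (card X) else 0)"
      by (intro sum.cong refl) (simp add: orth)
    also have "\<dots> = (\<Sum>k\<in>F. ?g k * cnj (?g k) * of_nat (card X))"
      using F by simp
    also have "\<dots> = (\<Sum>k\<in>F. of_real (real (card X) * (l k * (cmod (q s k))\<^sup>2)))"
    proof (intro sum.cong refl)
      fix k assume "k \<in> F"
      then have "?g k * cnj (?g k) = of_real ((cmod (?g k))\<^sup>2)" "(cmod (?g k))\<^sup>2 = l k * (cmod (q s k))\<^sup>2"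
        using l[of k] by (simp_all only: complex_norm_square) (simp add: norm_mult power_mult_distrib)
      then show "?g k * cnj (?g k) * of_nat (card X) = of_real (real (card X) * (l k * (cmod (q s k))\<^sup>2))"
        by (simp only: of_real_mult of_real_of_nat_eq mult.commute)
    qed
    finally have "complex_of_real (\<Sum>y\<in>X. (cmod (ip F (\<kappa> y) (q s)))\<^sup>2) =
        of_real (real (card X) * (\<Sum>k\<in>F. l k * (cmod (q s k))\<^sup>2))"
      unfolding of_real_sum complex_norm_square[symmetric] sum_distrib_left .
    then show ?thesis by (simp only: of_real_eq_iff)
  qed
  have "real (card X) * ((\<Sum>k\<in>F. l k) - E\<^sup>2) \<le> (\<Sum>y\<in>X. \<Sum>s<r. (cmod (ip F (\<kappa> y) (q s)))\<^sup>2)"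
    using pointwise by (intro sum_bounded_below) force
  also have "\<dots> = real (card X) * (\<Sum>s<r. \<Sum>k\<in>F. l k * (cmod (q s k))\<^sup>2)"
    by (subst sum.swap) (simp add: avg sum_distrib_left)
  also have "(\<Sum>s<r. \<Sum>k\<in>F. l k * (cmod (q s k))\<^sup>2) = (\<Sum>k\<in>F. l k * t k)"
    by (subst sum.swap) (simp add: t_def sum_distrib_left)
  finally have main: "(\<Sum>k\<in>F. l k) - E\<^sup>2 \<le> (\<Sum>k\<in>F. l k * t k)"
    using X by (simp add: card_gt_0_iff)
  \<comment> \<open>Bessel's inequality for the unit vector at \<open>k\<close>.\<close>
  have t1: "t k \<le> 1" if k: "k \<in> F" for k
  proof -
    let ?d = "\<lambda>j. if j = k then 1 else 0 :: complex"
    have "ip F ?d (q s) = cnj (q s k)" for s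
      using k F by (simp add: ip_def if_distrib[of "\<lambda>x. x * _"] cong: if_cong)
    moreover have "(\<Sum>j\<in>F. (cmod (?d j))\<^sup>2) = 1"
      using k F by (simp add: if_distrib[of "\<lambda>x. (cmod x)\<^sup>2"] cong: if_cong)
    ultimately have "(\<Sum>j\<in>F. (cmod (residual F r q ?d j))\<^sup>2) = 1 - t k"
      unfolding norm_residual[OF q(2)] t_def by simp
    moreover have "0 \<le> (\<Sum>j\<in>F. (cmod (residual F r q ?d j))\<^sup>2)" by (simp add: sum_nonneg)
    ultimately show ?thesis by simp
  qed
  have t0: "0 \<le> t k" for k by (simp add: t_def sum_nonneg)
  have "(\<Sum>k\<in>F. t k) = (\<Sum>s<r. \<Sum>k\<in>F. (cmod (q s k))\<^sup>2)"
    unfolding t_def by (rule sum.swap)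
  also have "\<dots> = (\<Sum>s<r. 1)"
    using q(2) by (intro sum.cong) (auto simp: ip_self_Re orthonormal_def)
  finally have tn: "(\<Sum>k\<in>F. t k) \<le> real (card J)" using q(1) F(3) by simp
  have fJ: "finite J" using F finite_subset by blast
  \<comment> \<open>\<open>\<theta>\<close> separates the weights in \<open>J\<close> from the
    others: the least weight in \<open>J\<close>, or for empty \<open>J\<close> the sum of all
    weights as an upper bound.\<close>
  obtain \<theta> where \<theta>: "0 \<le> \<theta>" "\<And>k. k \<in> J \<Longrightarrow> \<theta> \<le> l k" "\<And>k. k \<in> F - J \<Longrightarrow> l k \<le> \<theta>"
  proof (cases "J = {}")
    case True
    show ?thesis
    proof (rule that[of "\<Sum>k\<in>F. l k"])
      show "l k \<le> (\<Sum>k\<in>F. l k)" if "k \<in> F - J" for k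
        using that F l by (intro member_le_sum) auto
    qed (use True l in \<open>auto intro: sum_nonneg\<close>)
  next
    case False
    have "Min (l ` J) \<in> l ` J" using fJ False by simp
    then obtain k0 where k0: "k0 \<in> J" "Min (l ` J) = l k0" by auto
    show ?thesis
    proof (rule that[of "l k0"])
      show "0 \<le> l k0" using k0 F l by blast
      show "l k0 \<le> l k" if "k \<in> J" for k using that fJ k0(2) by (metis Min_le finite_imageI imageI)
      show "l k \<le> l k0" if "k \<in> F - J" for k using J k0 that by blast
    qed
  qed
  have split: "(\<Sum>k\<in>F. g k) = (\<Sum>k\<in>F - J. g k) + (\<Sum>k\<in>J. g k)" for g :: "'k \<Rightarrow> real"
    by (rule sum.subset_diff[OF F(2,1)])
  \<comment> \<open>Exchange argument: the mass of \<open>t\<close> outside \<open>J\<close> is at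
    most the room \<open>1 - t\<close> left inside \<open>J\<close>, where every weight is at least
    \<open>\<theta>\<close>.\<close>
  have "(\<Sum>k\<in>F - J. l k * t k) \<le> (\<Sum>k\<in>F - J. \<theta> * t k)"
    using t0 \<theta> by (intro sum_mono mult_right_mono) auto
  also have "\<dots> = \<theta> * ((\<Sum>k\<in>F. t k) - (\<Sum>k\<in>J. t k))"
    using split[of t] by (simp add: sum_distrib_left)
  also have "\<dots> \<le> \<theta> * (\<Sum>k\<in>J. 1 - t k)"
    using tn \<theta>(1) by (intro mult_left_mono) (auto simp: sum_subtractf)
  also have "\<dots> \<le> (\<Sum>k\<in>J. l k * (1 - t k))"
    unfolding sum_distrib_left using t1 \<theta>(2) F(2) by (intro sum_mono mult_right_mono) auto
  also have "\<dots> = (\<Sum>k\<in>J. l k) - (\<Sum>k\<in>J. l k * t k)"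
    by (simp add: right_diff_distrib sum_subtractf)
  finally have "(\<Sum>k\<in>F. l k * t k) \<le> (\<Sum>k\<in>J. l k)" using split[of "\<lambda>k. l k * t k"] by simp
  with main split[of l] show ?thesis by simp
qed

text \<open>Greedy choice: a largest remaining weight is added to \<open>J\<close>. It exists
  because, by summability, only finitely many weights are at least that of a given
  \<open>k0\<close>.\<close>

lemma exists_top_set:
  fixes l :: "'k \<Rightarrow> real"
  assumes Z: "infinite Z" and l: "\<And>k. k \<in> Z \<Longrightarrow> 0 < l k" "l summable_on Z"
  obtains J where "J \<subseteq> Z" "finite J" "card J = m" "\<And>k k'. k \<in> J \<Longrightarrow> k' \<in> Z - J \<Longrightarrow> l k' \<le> l k"
proof (induction m arbitrary: thesis)
  case 0
  show ?case by (rule 0[of "{}"]) auto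
next
  case (Suc m)
  obtain J where J: "J \<subseteq> Z" "finite J" "card J = m" "\<And>k k'. k \<in> J \<Longrightarrow> k' \<in> Z - J \<Longrightarrow> l k' \<le> l k"
    by (rule Suc.IH) blast
  have "infinite (Z - J)" using Z J by simp
  then obtain k0 where k0: "k0 \<in> Z - J" using finite.simps by (metis ex_in_conv)
  define A where "A = {k \<in> Z - J. l k0 \<le> l k}"
  have "finite A"
  proof (rule ccontr)
    assume "infinite A"
    \<comment> \<open>This many weights of size at least \<open>l k0\<close> would exceed the total
      sum.\<close>
    obtain n :: nat where n: "infsum l Z / l k0 < real n" using reals_Archimedean2 by blast
    obtain B where B: "finite B" "card B = n" "B \<subseteq> A" using infinite_arbitrarily_large[OF \<open>infinite A\<close>] by blast
    have "real n * l k0 \<le> sum l B"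
      using B by (simp add: A_def sum_bounded_below subset_iff flip: B(2))
    also have "\<dots> \<le> infsum l Z"
      using B l by (intro finite_sum_le_infsum) (auto simp: A_def less_imp_le subset_iff)
    finally show False using n l(1)[of k0] k0 by (simp add: field_simps)
  qed
  moreover have "k0 \<in> A" using k0 by (simp add: A_def)
  ultimately obtain k1 where k1: "k1 \<in> A" "\<And>k. k \<in> A \<Longrightarrow> l k \<le> l k1"
    using Max_in[of "l ` A"] Max_ge[of "l ` A"] by (metis empty_iff finite_imageI image_iff)
  show ?case
  proof (rule Suc.prems[of "insert k1 J"])
    show "insert k1 J \<subseteq> Z" "finite (insert k1 J)" "card (insert k1 J) = Suc m"
      using J k1 by (auto simp: A_def)
    fix k k' assume k: "k \<in> insert k1 J" "k' \<in> Z - insert k1 J"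
    show "l k' \<le> l k"
    proof (cases "k = k1")
      case True
      show ?thesis
      proof (cases "k' \<in> A")
        case False
        then have "l k' \<le> l k0" using k by (auto simp: A_def)
        also have "\<dots> \<le> l k1" using k1(2) \<open>k0 \<in> A\<close> by blast
        finally show ?thesis using True by simp
      qed (use k1 True in auto)
    qed (use J k in auto)
  qed
qed

section \<open>Trigonometric polynomials on the torus\<close>

lemma ekx_mult_cnj:
  "ekx d k x * cnj (ekx d k' x) = (\<Prod>i<d. cis (2 * pi * (of_int (k i - k' i) * x i)))"
proof -
  have *: "(\<Prod>i<d. cis (f i)) = cis (\<Sum>i<d. f i)" for f :: "nat \<Rightarrow> real"
    by (induction d) (auto simp: cis_mult)
  show ?thesis
    unfolding ekx_def cis_cnj cis_mult *
    by (simp add: sum_distrib_left right_diff_distrib left_diff_distrib sum_subtractf mult_ac)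
qed

lemma norm_ekx [simp]: "cmod (ekx d k x) = 1"
  by (simp add: ekx_def)

lemma Zd_neqE:
  assumes "k \<in> Zd d" "k' \<in> Zd d" "k \<noteq> k'"
  obtains i where "i < d" "k i \<noteq> k' i"
proof -
  from assms(3) obtain i where i: "k i \<noteq> k' i" by blast
  moreover have "i < d" using assms(1,2) i by (cases "i < d") (auto simp: Zd_def)
  ultimately show ?thesis by (intro that)
qed

lemma infinite_Zd:
  assumes "1 \<le> d"
  shows "infinite (Zd d)"
proof
  assume "finite (Zd d)"
  moreover have "range (\<lambda>n::int. (\<lambda>i::nat. if i = 0 then n else 0)) \<subseteq> Zd d"
    using assms by (auto simp: Zd_def)
  moreover have "inj (\<lambda>n::int. (\<lambda>i::nat. if i = 0 then n else 0))"
    by (rule injI) (metis)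
  ultimately show False
    using finite_imageD[of "\<lambda>n::int. (\<lambda>i::nat. if i = 0 then n else 0)" UNIV] finite_subset infinite_UNIV_int by blast
qed

text \<open>For nonzero \<open>n\<close> this is a geometric sum over an \<open>N\<close>-th root of
  unity, which differs from 1 because \<open>n\<close> is not a multiple of
  \<open>N\<close>.\<close>

lemma sum_cis_grid:
  assumes "\<bar>n\<bar> < int N"
  shows "(\<Sum>j<N. cis (2 * pi * (of_int n * (real j / real N)))) = (if n = 0 then of_nat N else 0)"
proof (cases "n = 0")
  case False
  define z where "z = cis (2 * pi * of_int n / real N)"
  have N: "0 < N" using assms by auto
  have "z \<noteq> 1"
  proof
    assume "z = 1"
    then obtain m :: int where "2 * pi * of_int n / real N = of_int m * (2 * pi)"
      unfolding z_def cis_eq_1_iff by blast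
    then have "real_of_int n = of_int (m * int N)" using N by (simp add: field_simps)
    then have "n = m * int N" by (simp only: of_int_eq_iff)
    then have "\<bar>n\<bar> = \<bar>m\<bar> * int N" by (simp add: abs_mult)
    moreover have "m \<noteq> 0" using \<open>n = m * int N\<close> False by auto
    ultimately have "int N \<le> \<bar>n\<bar>" using mult_right_mono[of 1 "\<bar>m\<bar>" "int N"] by simp
    with assms show False by simp
  qed
  moreover have "z ^ N = 1"
    unfolding z_def Complex.DeMoivre using N cis_multiple_2pi[of "of_int n"] by simp
  ultimately have "(\<Sum>j<N. z ^ j) = 0" by (simp add: geometric_sum)
  moreover have "cis (2 * pi * (of_int n * (real j / real N))) = z ^ j" for j
    unfolding z_def Complex.DeMoivre by (simp add: mult_ac)
  ultimately show ?thesis using False by simp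
qed simp

text \<open>On an equidistant product grid the sum factorises over the coordinates, and a coordinate
  with different frequencies contributes the factor zero.\<close>

lemma torus_grid:
  assumes F: "finite F" "F \<subseteq> Zd d"
  shows "\<exists>X. finite X \<and> X \<noteq> {} \<and> X \<subseteq> torus d \<and>
      (\<forall>k\<in>F. \<forall>k'\<in>F. (\<Sum>y\<in>X. ekx d k y * cnj (ekx d k' y)) = (if k = k' then of_nat (card X) else 0))"
proof -
  \<comment> \<open>\<open>N\<close> exceeds twice the modulus of every frequency component in
    \<open>F\<close>, so differences of components stay below \<open>N\<close> and no aliasing
    occurs.\<close>
  define N where "N = Suc (nat (2 * (\<Sum>k\<in>F. \<Sum>i<d. \<bar>k i\<bar>)))"
  have kN: "2 * \<bar>k i\<bar> < int N" if "k \<in> F" "i < d" for k i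
  proof -
    have "\<bar>k i\<bar> \<le> (\<Sum>i<d. \<bar>k i\<bar>)" using that by (intro member_le_sum) auto
    also have "\<dots> \<le> (\<Sum>k\<in>F. \<Sum>i<d. \<bar>k i\<bar>)"
      using that F by (intro member_le_sum[of k F "\<lambda>k. \<Sum>i<d. \<bar>k i\<bar>"]) (auto intro: sum_nonneg)
    finally show ?thesis by (simp add: N_def)
  qed
  define G where "G = (\<lambda>j. real j / real N) ` {..<N}"
  define X where "X = {..<d} \<rightarrow>\<^sub>E G"
  have inj: "inj_on (\<lambda>j. real j / real N) {..<N}" by (auto simp: inj_on_def N_def)
  then have cG: "card G = N" "finite G" by (simp_all add: G_def card_image)
  have "(\<Sum>y\<in>X. ekx d k y * cnj (ekx d k' y)) = (if k = k' then of_nat (card X) else 0)"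
    if k: "k \<in> F" "k' \<in> F" for k k'
  proof -
    have "(\<Sum>y\<in>X. ekx d k y * cnj (ekx d k' y)) = (\<Prod>i<d. \<Sum>y\<in>G. cis (2 * pi * (of_int (k i - k' i) * y)))"
      unfolding ekx_mult_cnj X_def using cG by (subst prod_sum_PiE) auto
    also have "\<dots> = (\<Prod>i<d. if k i = k' i then of_nat N else 0)"
    proof (intro prod.cong refl)
      fix i assume "i \<in> {..<d}"
      then have "\<bar>k i - k' i\<bar> < int N" using kN[of k i] kN[of k' i] k by simp
      then show "(\<Sum>y\<in>G. cis (2 * pi * (of_int (k i - k' i) * y))) = (if k i = k' i then of_nat N else 0)"
        unfolding G_def sum.reindex[OF inj] comp_def by (simp only: sum_cis_grid right_minus_eq)
    qed
    also have "\<dots> = (if k = k' then of_nat (card X) else 0)"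
    proof (cases "k = k'")
      case True
      then show ?thesis by (simp add: X_def card_PiE cG)
    next
      case False
      then obtain i where "i < d" "k i \<noteq> k' i" using k F by (metis Zd_neqE subsetD)
      then have "(\<Prod>i<d. if k i = k' i then of_nat N else (0::complex)) = 0"
        by (intro prod_zero) auto
      with False show ?thesis by simp
    qed
    finally show ?thesis .
  qed
  moreover have "finite X" "X \<noteq> {}" using cG unfolding X_def by (auto intro!: finite_PiE simp: PiE_eq_empty_iff N_def)
  moreover have "G \<subseteq> {0..1}" by (auto simp: G_def divide_simps N_def)
  then have "X \<subseteq> torus d" unfolding X_def torus_def by (intro PiE_mono) auto
  ultimately show ?thesis by blast
qed

section \<open>Measure on the torus and orthonormality of exponentials\<close>

abbreviation unit_interval :: "real measure" where
  "unit_interval \<equiv> restrict_space lborel {0..1}"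

lemma emeasure_unit_interval: "0 \<le> a \<Longrightarrow> a \<le> b \<Longrightarrow> b \<le> 1 \<Longrightarrow> emeasure unit_interval {a..b} = ennreal (b - a)"
  by (subst emeasure_restrict_space) auto

interpretation unit_interval: finite_measure unit_interval
  by standard (simp add: emeasure_restrict_space space_restrict_space)

interpretation unit_intervals: product_sigma_finite "\<lambda>_::nat. unit_interval"
  by standard

lemma space_Tmeas: "space (Tmeas d) = torus d"
  by (simp add: Tmeas_def torus_def space_PiM space_restrict_space)

interpretation Tmeas: finite_measure "Tmeas d"
proof
  have "emeasure (Tmeas d) (space (Tmeas d)) = emeasure (Tmeas d) ({..<d} \<rightarrow>\<^sub>E {0..1})"
    by (simp add: space_Tmeas torus_def)
  also have "\<dots> = (\<Prod>i<d. emeasure unit_interval {0..1})"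
    unfolding Tmeas_def by (rule unit_intervals.emeasure_PiM) (auto simp: sets_restrict_space_iff)
  finally show "emeasure (Tmeas d) (space (Tmeas d)) \<noteq> \<infinity>"
    by (simp add: emeasure_unit_interval)
qed

lemma measurable_coordinate_Tmeas:
  assumes "i < d"
  shows "(\<lambda>x. x i) \<in> borel_measurable (Tmeas d)"
proof -
  have "(\<lambda>x. x i) \<in> measurable (Tmeas d) unit_interval"
    unfolding Tmeas_def using assms by (intro measurable_component_singleton) simp
  moreover have "(\<lambda>x. x) \<in> measurable unit_interval borel"
    by (intro measurable_restrict_space1) simp
  ultimately show ?thesis using measurable_compose by blast
qed

lemma measurable_cis: "cis \<in> borel_measurable borel"
  by (intro borel_measurable_continuous_onI continuous_intros)

lemma measurable_ekx: "ekx d k \<in> borel_measurable (Tmeas d)"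
  unfolding ekx_def
  by (intro measurable_compose[OF _ measurable_cis] borel_measurable_times borel_measurable_sum
      borel_measurable_const measurable_coordinate_Tmeas) auto

lemma integral_cis_unit_interval:
  "integral\<^sup>L unit_interval (\<lambda>y. cis (2 * pi * (of_int n * y))) = (if n = 0 then 1 else 0)"
proof -
  have "integral\<^sup>L unit_interval (\<lambda>y. cis (2 * pi * (of_int n * y))) =
      (LBINT y:{0..1}. cis (2 * pi * (of_int n * y)))"
    by (subst integral_restrict_space) (auto simp: set_lebesgue_integral_def)
  also have "\<dots> = integral {0..1} (\<lambda>y. cis (2 * pi * (of_int n * y)))"
    by (intro set_borel_integral_eq_integral borel_integrable_atLeastAtMost' continuous_intros)
  also have "\<dots> = (if n = 0 then 1 else 0)"
  proof (cases "n = 0")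
    case False
    define w where "w = 2 * pi * of_int n"
    have w: "w \<noteq> 0" using False by (simp add: w_def)
    have "((\<lambda>y. cis (w * y)) has_integral (cis (w * 1) / (\<i> * of_real w) - cis (w * 0) / (\<i> * of_real w))) {0..1}"
    proof (rule fundamental_theorem_of_calculus)
      fix y assume "y \<in> {0..1::real}"
      have "((\<lambda>y. exp (\<i> * of_real w * y) / (\<i> * of_real w)) has_field_derivative exp (\<i> * of_real w * of_real y))
          (at (of_real y))"
        using w by (auto intro!: derivative_eq_intros)
      from has_vector_derivative_real_field[OF this]
      have "((\<lambda>y. exp (\<i> * of_real w * of_real y) / (\<i> * of_real w)) has_vector_derivative exp (\<i> * of_real w * of_real y))
          (at y within {0..1})" .
      then show "((\<lambda>y. cis (w * y) / (\<i> * of_real w)) has_vector_derivative cis (w * y)) (at y within {0..1})"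
        by (simp add: cis_conv_exp mult_ac)
    qed simp
    moreover have "cis w = 1" unfolding w_def by (rule cis_multiple_2pi) simp
    ultimately have "((\<lambda>y. cis (w * y)) has_integral 0) {0..1}" by simp
    then show ?thesis using False by (simp add: w_def integral_unique mult_ac)
  qed simp
  finally show ?thesis .
qed

lemma integral_ekx_orthonormal:
  assumes "k \<in> Zd d" "k' \<in> Zd d"
  shows "integral\<^sup>L (Tmeas d) (\<lambda>x. ekx d k x * cnj (ekx d k' x)) = (if k = k' then 1 else 0)"
proof -
  have "integrable unit_interval (\<lambda>y. cis (2 * pi * (of_int n * y)))" for n :: int
  proof (rule unit_interval.integrable_const_bound[where B = 1])
    show "(\<lambda>y. cis (2 * pi * (of_int n * y))) \<in> borel_measurable unit_interval"
      by (intro measurable_restrict_space1 measurable_compose[OF _ measurable_cis]) simp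
  qed simp
  then have "integral\<^sup>L (Tmeas d) (\<lambda>x. ekx d k x * cnj (ekx d k' x)) =
     (\<Prod>i<d. integral\<^sup>L unit_interval (\<lambda>y. cis (2 * pi * (of_int (k i - k' i) * y))))"
    unfolding ekx_mult_cnj Tmeas_def by (intro unit_intervals.product_integral_prod) (simp_all del: of_int_diff)
  also have "\<dots> = (\<Prod>i<d. if k i = k' i then 1 else 0)"
    by (intro prod.cong refl) (simp only: integral_cis_unit_interval right_minus_eq)
  also have "\<dots> = (if k = k' then 1 else 0)"
  proof (cases "k = k'")
    case False
    then obtain i where "i < d" "k i \<noteq> k' i" using assms by (metis Zd_neqE)
    then have "(\<Prod>i<d. if k i = k' i then 1 else (0::complex)) = 0"
      by (intro prod_zero) auto
    with False show ?thesis by simp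
  qed simp
  finally show ?thesis .
qed

text \<open>The value 0 off the torus is the normalisation that \<open>Hsp\<close> demands. These
  are the test functions for the lower bound.\<close>

definition trig_poly :: "nat \<Rightarrow> freq set \<Rightarrow> (freq \<Rightarrow> complex) \<Rightarrow> fn" where
  "trig_poly d F a = (\<lambda>x. if x \<in> torus d then \<Sum>k\<in>F. a k * ekx d k x else 0)"

lemma fhat_trig_poly:
  assumes F: "finite F" "F \<subseteq> Zd d" and k': "k' \<in> Zd d"
  shows "fhat d (trig_poly d F a) k' = (if k' \<in> F then a k' else 0)"
proof -
  have int: "integrable (Tmeas d) (\<lambda>x. ekx d k x * cnj (ekx d k' x))" for k
  proof (rule Tmeas.integrable_const_bound[where B = 1])
    show "(\<lambda>x. ekx d k x * cnj (ekx d k' x)) \<in> borel_measurable (Tmeas d)"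
      by (intro borel_measurable_times measurable_ekx measurable_compose[OF measurable_ekx]
          borel_measurable_continuous_onI continuous_intros)
  qed (simp add: norm_mult)
  have "fhat d (trig_poly d F a) k' = integral\<^sup>L (Tmeas d) (\<lambda>x. \<Sum>k\<in>F. a k * (ekx d k x * cnj (ekx d k' x)))"
    unfolding fhat_def trig_poly_def
    by (intro Bochner_Integration.integral_cong) (auto simp: space_Tmeas sum_distrib_left mult_ac)
  also have "\<dots> = (\<Sum>k\<in>F. a k * integral\<^sup>L (Tmeas d) (\<lambda>x. ekx d k x * cnj (ekx d k' x)))"
    using int by (subst Bochner_Integration.integral_sum) auto
  also have "\<dots> = (\<Sum>k\<in>F. if k = k' then a k' else 0)"
    using F k' by (intro sum.cong refl) (auto simp: integral_ekx_orthonormal)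
  finally show ?thesis using F by simp
qed

lemma trig_poly_Hsp:
  assumes F: "finite F" "F \<subseteq> Zd d"
  shows "trig_poly d F a \<in> Hsp \<omega> d"
proof -
  have meas: "trig_poly d F a \<in> borel_measurable (Tmeas d)"
  proof (subst measurable_cong)
    show "trig_poly d F a x = (\<Sum>k\<in>F. a k * ekx d k x)" if "x \<in> space (Tmeas d)" for x
      using that by (simp add: trig_poly_def space_Tmeas)
    show "(\<lambda>x. \<Sum>k\<in>F. a k * ekx d k x) \<in> borel_measurable (Tmeas d)"
      by (intro borel_measurable_sum borel_measurable_times borel_measurable_const measurable_ekx)
  qed
  have bound: "cmod (trig_poly d F a x) \<le> (\<Sum>k\<in>F. cmod (a k))" for x
    unfolding trig_poly_def by (auto intro!: order_trans[OF norm_sum] sum_nonneg simp: norm_mult)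
  have "integrable (Tmeas d) (\<lambda>x. (cmod (trig_poly d F a x))\<^sup>2)"
  proof (rule Tmeas.integrable_const_bound[where B = "(\<Sum>k\<in>F. cmod (a k))\<^sup>2"])
    show "(\<lambda>x. (cmod (trig_poly d F a x))\<^sup>2) \<in> borel_measurable (Tmeas d)"
      using meas by measurable
  qed (auto intro!: power_mono bound)
  moreover have "(\<lambda>k. (cmod (fhat d (trig_poly d F a) k))\<^sup>2 * (\<omega> d k)\<^sup>2) summable_on Zd d"
    by (rule has_sum_imp_summable, rule has_sum_finite_neutralI[OF F _ refl]) (auto simp: fhat_trig_poly[OF F])
  moreover have "((\<lambda>k. fhat d (trig_poly d F a) k * ekx d k x) has_sum trig_poly d F a x) (Zd d)" if "x \<in> torus d" for x
  proof (rule has_sum_finite_neutralI[OF F])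
    have "trig_poly d F a x = (\<Sum>k\<in>F. a k * ekx d k x)" using that by (simp add: trig_poly_def)
    then show "trig_poly d F a x = (\<Sum>k\<in>F. fhat d (trig_poly d F a) k * ekx d k x)"
      using F by (simp add: fhat_trig_poly[OF F] subset_iff)
  qed (simp add: fhat_trig_poly[OF F])
  ultimately show ?thesis using meas by (simp add: Hsp_def) (simp add: trig_poly_def)
qed

lemma Hnorm_trig_poly:
  assumes F: "finite F" "F \<subseteq> Zd d"
  shows "Hnorm \<omega> d (trig_poly d F a) = sqrt (\<Sum>k\<in>F. (cmod (a k))\<^sup>2 * (\<omega> d k)\<^sup>2)"
proof -
  have "((\<lambda>k. (cmod (fhat d (trig_poly d F a) k))\<^sup>2 * (\<omega> d k)\<^sup>2) has_sum (\<Sum>k\<in>F. (cmod (a k))\<^sup>2 * (\<omega> d k)\<^sup>2)) (Zd d)"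
    using F by (intro has_sum_finite_neutralI[OF F]) (auto simp: fhat_trig_poly[OF F] subset_iff intro!: sum.cong)
  then show ?thesis unfolding Hnorm_def by (simp add: infsumI)
qed

text \<open>The values at single exponentials determine the functional, which becomes a finite
  linear form in the coefficients. Linearity is available inside \<open>Hsp\<close>, so each partial
  sum is checked to lie there.\<close>

lemma Lall_trig_poly:
  assumes L: "L \<in> Lall \<omega> d" and F: "finite F" "F \<subseteq> Zd d"
  shows "L (trig_poly d F a) = (\<Sum>k\<in>F. a k * L (trig_poly d {k} (\<lambda>_. 1)))"
  using F
proof (induction F rule: finite_induct)
  have lin: "L (\<lambda>x. s * f x + t * g x) = s * L f + t * L g" if "f \<in> Hsp \<omega> d" "g \<in> Hsp \<omega> d" for f g s t
    using L that by (simp add: Lall_def)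
  {
    case empty
    have "trig_poly d {} a \<in> Hsp \<omega> d" by (rule trig_poly_Hsp) auto
    moreover have "trig_poly d {} a = (\<lambda>x. 0)" by (auto simp: trig_poly_def)
    ultimately show ?case using lin[of "trig_poly d {} a" "trig_poly d {} a" 0 0] by simp
  next
    case (insert k F)
    have "trig_poly d (insert k F) a = (\<lambda>x. a k * trig_poly d {k} (\<lambda>_. 1) x + 1 * trig_poly d F a x)"
      using insert.hyps by (auto simp: trig_poly_def)
    moreover have "trig_poly d {k} (\<lambda>_. 1) \<in> Hsp \<omega> d" "trig_poly d F a \<in> Hsp \<omega> d"
      using insert by (auto intro!: trig_poly_Hsp)
    ultimately show ?case
      using insert lin[of "trig_poly d {k} (\<lambda>_. 1)" "trig_poly d F a" "a k" 1] by simp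
  }
qed

text \<open>The box of radius \<open>\<eta>\<close> around \<open>x\<close>, cut down to the unit
  cube, has positive measure, so no null set contains it.\<close>

lemma torus_minus_null_dense:
  assumes N: "N \<in> null_sets (Tmeas d)" and x: "x \<in> torus d" and \<eta>: "0 < \<eta>"
  obtains y where "y \<in> torus d - N" "\<And>i. i < d \<Longrightarrow> \<bar>y i - x i\<bar> \<le> \<eta>"
proof -
  define a where "a i = max 0 (x i - \<eta>)" for i
  define b where "b i = min 1 (x i + \<eta>)" for i
  have xi: "0 \<le> x i" "x i \<le> 1" if "i < d" for i using x that by (auto simp: torus_def PiE_iff)
  have ab: "0 \<le> a i" "a i < b i" "b i \<le> 1" if "i < d" for i
    using xi[OF that] \<eta> by (auto simp: a_def b_def)
  let ?B = "PiE {..<d} (\<lambda>i. {a i..b i})"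
  have "emeasure (Tmeas d) ?B = (\<Prod>i<d. emeasure unit_interval {a i..b i})"
    unfolding Tmeas_def using ab
    by (intro unit_intervals.emeasure_PiM) (auto simp: sets_restrict_space_iff less_imp_le)
  also have "\<dots> = (\<Prod>i<d. ennreal (b i - a i))"
    using ab by (intro prod.cong refl emeasure_unit_interval) (auto simp: less_imp_le)
  also have "\<dots> \<noteq> 0" using ab by (auto simp: ennreal_eq_0_iff not_le)
  finally have pos: "emeasure (Tmeas d) ?B \<noteq> 0" .
  have "\<not> ?B \<subseteq> N"
  proof
    assume "?B \<subseteq> N"
    then have "emeasure (Tmeas d) ?B \<le> emeasure (Tmeas d) N" using N by (intro emeasure_mono) auto
    with pos N show False by auto
  qed
  then obtain y where y: "y \<in> ?B" "y \<notin> N" by blast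
  have "{a i..b i} \<subseteq> {0..1}" if "i < d" for i using ab[OF that] by auto
  then have "y \<in> torus d" using y(1) unfolding torus_def by (meson PiE_mono lessThan_iff subsetD)
  moreover have "\<bar>y i - x i\<bar> \<le> \<eta>" if "i < d" for i
  proof -
    have "a i \<le> y i" "y i \<le> b i" using y(1) that by (auto simp: PiE_iff)
    then show ?thesis by (auto simp: a_def b_def)
  qed
  ultimately show ?thesis using y(2) that by blast
qed

text \<open>Points outside the null set approach \<open>x\<close>, and trigonometric polynomials are
  continuous on the torus; so essential bounds become pointwise ones.\<close>

lemma trig_poly_le_of_AE_le:
  assumes N: "N \<in> null_sets (Tmeas d)" and le: "\<And>y. y \<in> torus d - N \<Longrightarrow> cmod (trig_poly d F a y) \<le> B"
    and x: "x \<in> torus d"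
  shows "cmod (trig_poly d F a x) \<le> B"
proof -
  have "\<exists>y. y \<in> torus d - N \<and> (\<forall>i<d. \<bar>y i - x i\<bar> \<le> 1 / Suc n)" for n
    by (rule torus_minus_null_dense[OF N x, of "1 / Suc n"]) auto
  then obtain y where y: "\<And>n. y n \<in> torus d - N" "\<And>n i. i < d \<Longrightarrow> \<bar>y n i - x i\<bar> \<le> 1 / Suc n"
    by metis
  have lim: "(\<lambda>n. y n i) \<longlonglongrightarrow> x i" if "i < d" for i
  proof (rule LIM_zero_cancel, rule Lim_null_comparison)
    show "\<forall>\<^sub>F n in sequentially. norm (y n i - x i) \<le> 1 / Suc n" using y(2)[OF that] by simp
    show "(\<lambda>n. 1 / real (Suc n)) \<longlonglongrightarrow> 0" by (rule LIMSEQ_Suc[OF lim_1_over_n])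
  qed
  have "(\<lambda>n. \<Sum>k\<in>F. a k * ekx d k (y n)) \<longlonglongrightarrow> (\<Sum>k\<in>F. a k * ekx d k x)"
    unfolding ekx_def by (intro tendsto_intros lim) auto
  moreover have "(\<lambda>n. \<Sum>k\<in>F. a k * ekx d k (y n)) = (\<lambda>n. trig_poly d F a (y n))"
    using y(1) by (auto simp: trig_poly_def)
  moreover have "(\<Sum>k\<in>F. a k * ekx d k x) = trig_poly d F a x"
    using x by (simp add: trig_poly_def)
  ultimately have "(\<lambda>n. cmod (trig_poly d F a (y n))) \<longlonglongrightarrow> cmod (trig_poly d F a x)"
    by (simp add: tendsto_norm)
  then show ?thesis by (rule LIMSEQ_le_const2) (use le y(1) in blast)
qed

lemma Linf_leD:
  assumes "Linf d g \<le> ereal E" "0 < \<delta>"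
  obtains N where "N \<in> null_sets (Tmeas d)" "\<And>x. x \<in> torus d - N \<Longrightarrow> cmod (g x) \<le> E + \<delta>"
proof -
  have "Linf d g < ereal (E + \<delta>)" using assms by (meson ereal_less_eq(3) le_less_trans less_add_same_cancel1 less_ereal.simps(1))
  then obtain z N where z: "z < ereal (E + \<delta>)" and N: "N \<in> null_sets (Tmeas d)"
    "\<And>x. x \<in> torus d - N \<Longrightarrow> ereal (cmod (g x)) \<le> z"
    unfolding Linf_def Inf_less_iff by blast
  show ?thesis
  proof (rule that[OF N(1)])
    show "cmod (g x) \<le> E + \<delta>" if "x \<in> torus d - N" for x
      using le_less_trans[OF N(2)[OF that] z] by simp
  qed
qed

text \<open>The functions \<open>f\<close> and \<open>- f\<close> share the same zero information, hence the same approximation \<open>g\<close>.\<close>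
lemma trig_poly_le_of_Linf_le:
  assumes 1: "Linf d (\<lambda>x. trig_poly d F a x - g x) \<le> ereal E"
    and 2: "Linf d (\<lambda>x. - trig_poly d F a x - g x) \<le> ereal E" and x: "x \<in> torus d"
  shows "cmod (trig_poly d F a x) \<le> E"
proof (rule field_le_epsilon)
  fix \<delta> :: real assume \<delta>: "0 < \<delta>"
  obtain N1 where N1: "N1 \<in> null_sets (Tmeas d)" "\<And>x. x \<in> torus d - N1 \<Longrightarrow> cmod (trig_poly d F a x - g x) \<le> E + \<delta>"
    by (rule Linf_leD[OF 1 \<delta>]) blast
  obtain N2 where N2: "N2 \<in> null_sets (Tmeas d)" "\<And>x. x \<in> torus d - N2 \<Longrightarrow> cmod (- trig_poly d F a x - g x) \<le> E + \<delta>"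
    by (rule Linf_leD[OF 2 \<delta>]) blast
  show "cmod (trig_poly d F a x) \<le> E + \<delta>"
  proof (rule trig_poly_le_of_AE_le[OF _ _ x])
    show "N1 \<union> N2 \<in> null_sets (Tmeas d)" using N1 N2 by blast
    fix y assume y: "y \<in> torus d - (N1 \<union> N2)"
    \<comment> \<open>The unknown approximation \<open>g\<close> cancels in the difference of the
      two errors.\<close>
    have "2 * cmod (trig_poly d F a y) = cmod ((trig_poly d F a y - g y) - (- trig_poly d F a y - g y))"
      by (simp flip: mult_2 add: norm_mult)
    also have "\<dots> \<le> cmod (trig_poly d F a y - g y) + cmod (- trig_poly d F a y - g y)"
      by (rule norm_triangle_ineq4)
    also have "\<dots> \<le> (E + \<delta>) + (E + \<delta>)" using N1(2)[of y] N2(2)[of y] y by (intro add_mono) auto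
    finally show "cmod (trig_poly d F a y) \<le> E + \<delta>" by simp
  qed
qed

section \<open>Comparison of the two information classes\<close>

locale weights =
  fixes \<omega> :: weight and d :: nat
  assumes d: "1 \<le> d" and pos: "k \<in> Zd d \<Longrightarrow> 0 < \<omega> d k"
    and summ: "(\<lambda>k. \<omega> d k powr (-2)) summable_on Zd d"
begin

text \<open>The kernel weights: the squared norm of \<open>f\<close> is the sum of
  \<open>(cmod (fhat d f k))\<^sup>2 / lam k\<close>.\<close>

definition lam :: "freq \<Rightarrow> real" where "lam k = 1 / (\<omega> d k)\<^sup>2"

lemma lam_pos: "k \<in> Zd d \<Longrightarrow> 0 < lam k"
  using pos[of k] by (simp add: lam_def)

lemma lam_summable: "lam summable_on Zd d"
proof -
  have "\<omega> d k powr (-2) = lam k" if "k \<in> Zd d" for k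
    using pos[OF that] by (simp add: lam_def powr_minus powr_numeral divide_inverse)
  with summ show ?thesis by (subst summable_on_cong[symmetric]) auto
qed

sublocale weighted_features "Zd d" lam "ekx d" "torus d"
  using infinite_Zd[OF d] lam_pos lam_summable torus_grid by unfold_locales auto

lemma unitball_coeff:
  assumes f: "f \<in> unitball \<omega> d" and F: "finite F" "F \<subseteq> Zd d"
  shows "(\<Sum>k\<in>F. (cmod (fhat d f k))\<^sup>2 * (\<omega> d k)\<^sup>2) \<le> 1"
proof -
  let ?g = "\<lambda>k. (cmod (fhat d f k))\<^sup>2 * (\<omega> d k)\<^sup>2"
  have "?g summable_on Zd d" and n: "sqrt (infsum ?g (Zd d)) \<le> 1"
    using f by (auto simp: unitball_def Hsp_def Hnorm_def)
  then have "sum ?g F \<le> infsum ?g (Zd d)"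
    using F by (intro finite_sum_le_infsum) auto
  also have "\<dots> \<le> 1" using n by (simp add: real_sqrt_le_1_iff)
  finally show ?thesis .
qed

text \<open>Cauchy-Schwarz for the Fourier series; the squared constant is the diagonal value of the
  kernel. Point evaluations are therefore continuous and belong to \<open>Lall\<close>.\<close>

lemma point_evaluation_le_Hnorm:
  assumes f: "f \<in> Hsp \<omega> d" and x: "x \<in> torus d"
  shows "cmod (f x) \<le> sqrt (infsum lam (Zd d)) * Hnorm \<omega> d f"
proof -
  let ?g = "\<lambda>k. (cmod (fhat d f k))\<^sup>2 * (\<omega> d k)\<^sup>2"
  have g: "?g summable_on Zd d" and hs: "((\<lambda>k. fhat d f k * ekx d k x) has_sum f x) (Zd d)"
    using f x by (auto simp: Hsp_def)
  have bound: "cmod (\<Sum>k\<in>F. fhat d f k * ekx d k x) \<le> sqrt (infsum lam (Zd d)) * Hnorm \<omega> d f"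
    if F: "finite F" "F \<subseteq> Zd d" for F
  proof -
    have "(cmod (\<Sum>k\<in>F. fhat d f k * ekx d k x))\<^sup>2 \<le>
        (\<Sum>k\<in>F. (cmod (fhat d f k))\<^sup>2 / lam k) * (\<Sum>k\<in>F. lam k * (cmod (ekx d k x))\<^sup>2)"
      using F lam_pos by (intro cmod_sum_mult_le_weighted) auto
    also have "\<dots> = sum ?g F * sum lam F" by (simp add: lam_def)
    also have "\<dots> \<le> infsum ?g (Zd d) * infsum lam (Zd d)"
      using F g lam_summable lam_pos
      by (intro mult_mono finite_sum_le_infsum infsum_nonneg sum_nonneg) (auto simp: less_imp_le subset_iff)
    finally have "sqrt ((cmod (\<Sum>k\<in>F. fhat d f k * ekx d k x))\<^sup>2) \<le> sqrt (infsum ?g (Zd d) * infsum lam (Zd d))"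
      by (rule real_sqrt_le_mono)
    then show ?thesis by (simp add: Hnorm_def real_sqrt_mult mult.commute)
  qed
  have lim: "((\<lambda>F. cmod (\<Sum>k\<in>F. fhat d f k * ekx d k x)) \<longlongrightarrow> cmod (f x)) (finite_subsets_at_top (Zd d))"
    using hs unfolding has_sum_def by (rule tendsto_norm)
  show ?thesis
    by (rule tendsto_upperbound[OF lim]) (auto intro!: eventually_finite_subsets_at_top_weakI bound)
qed

lemma Lstd_subset_Lall: "Lstd d \<subseteq> Lall \<omega> d"
  using point_evaluation_le_Hnorm by (auto simp: Lstd_def Lall_def)

text \<open>On trigonometric polynomials with frequencies in a finite set, the \<open>m\<close>
  functionals become \<open>m\<close> coefficient vectors. A polynomial in the unit ball with zero
  information is bounded by the error, since its negative produces the same data; so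
  \<open>trace_lower_bound\<close> applies. Letting the finite set grow gives the full tail.\<close>

lemma tail_le_err_Lall:
  assumes J: "J \<subseteq> Zd d" "finite J" "m \<le> card J"
    and top: "\<And>k k'. k \<in> J \<Longrightarrow> k' \<in> Zd d - J \<Longrightarrow> lam k' \<le> lam k"
  shows "ereal (sqrt (infsum lam (Zd d - J))) \<le> err \<omega> d (Lall \<omega> d) m"
  unfolding err_def
proof (rule INF_greatest, rule ereal_le_real)
  fix Lphi E
  assume A: "Lphi \<in> {(Ls, \<phi>). length Ls = m \<and> set Ls \<subseteq> Lall \<omega> d}"
    and E: "(SUP f\<in>unitball \<omega> d. Linf d (\<lambda>x. f x - snd Lphi (map (\<lambda>L. L f) (fst Lphi)) x)) \<le> ereal E"
  obtain Ls \<phi> where Lp: "Lphi = (Ls, \<phi>)" and Ls: "length Ls = m" "set Ls \<subseteq> Lall \<omega> d"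
    using A by (cases Lphi) auto
  have E': "Linf d (\<lambda>x. f x - \<phi> (map (\<lambda>L. L f) Ls) x) \<le> ereal E" if "f \<in> unitball \<omega> d" for f
    using E that by (auto simp: SUP_le_iff Lp)
  \<comment> \<open>The polynomial has coefficients \<open>a k * sqrt (lam k)\<close>, so its norm
    is the Euclidean norm of \<open>a\<close>, and each functional acts on \<open>a\<close> as an
    inner product with the displayed vector.\<close>
  have bound: "cmod (\<Sum>k\<in>F. a k * (of_real (sqrt (lam k)) * ekx d k y)) \<le> E"
    if F: "finite F" "F \<subseteq> Zd d" and y: "y \<in> torus d" and a1: "(\<Sum>k\<in>F. (cmod (a k))\<^sup>2) \<le> 1"
      and a0: "\<And>i. i < m \<Longrightarrow> ip F a (\<lambda>k. cnj (of_real (sqrt (lam k)) * (Ls ! i) (trig_poly d {k} (\<lambda>_. 1)))) = 0" for F a y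
  proof -
    have ball: "trig_poly d F b \<in> unitball \<omega> d" and zero: "map (\<lambda>L. L (trig_poly d F b)) Ls = replicate m 0"
      if b: "b = (\<lambda>k. s * (a k * of_real (sqrt (lam k))))" and s: "cmod s = 1" for b s
    proof -
      have "(\<Sum>k\<in>F. (cmod (b k))\<^sup>2 * (\<omega> d k)\<^sup>2) = (\<Sum>k\<in>F. (cmod (a k))\<^sup>2)"
      proof (intro sum.cong refl)
        fix k assume "k \<in> F"
        then have "0 < \<omega> d k" using F pos by blast
        then show "(cmod (b k))\<^sup>2 * (\<omega> d k)\<^sup>2 = (cmod (a k))\<^sup>2"
          by (simp add: b norm_mult norm_divide s power_mult_distrib lam_def real_sqrt_divide power_divide)
      qed
      then show "trig_poly d F b \<in> unitball \<omega> d"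
        using a1 trig_poly_Hsp[OF F] by (simp add: unitball_def Hnorm_trig_poly[OF F])
      have "(Ls ! i) (trig_poly d F b) = 0" if i: "i < m" for i
      proof -
        have "Ls ! i \<in> Lall \<omega> d" using Ls i by auto
        then have "(Ls ! i) (trig_poly d F b) = s * ip F a (\<lambda>k. cnj (of_real (sqrt (lam k)) * (Ls ! i) (trig_poly d {k} (\<lambda>_. 1))))"
          by (simp add: Lall_trig_poly[OF _ F] b ip_def sum_distrib_left mult_ac)
        with a0[OF i] show ?thesis by simp
      qed
      then show "map (\<lambda>L. L (trig_poly d F b)) Ls = replicate m 0"
        using Ls(1) by (intro nth_equalityI) auto
    qed
    let ?b = "\<lambda>k. 1 * (a k * of_real (sqrt (lam k)))" and ?b' = "\<lambda>k. (- 1) * (a k * of_real (sqrt (lam k)))"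
    have neg: "trig_poly d F ?b' = (\<lambda>x. - trig_poly d F ?b x)"
      by (auto simp: trig_poly_def sum_negf)
    have "Linf d (\<lambda>x. trig_poly d F ?b x - \<phi> (replicate m 0) x) \<le> ereal E"
      using E'[OF ball[OF refl, of 1]] zero[OF refl, of 1] by simp
    moreover have "Linf d (\<lambda>x. - trig_poly d F ?b x - \<phi> (replicate m 0) x) \<le> ereal E"
      using E'[OF ball[OF refl, of "- 1"]] zero[OF refl, of "- 1"] unfolding neg by simp
    ultimately have "cmod (trig_poly d F ?b y) \<le> E" using y by (rule trig_poly_le_of_Linf_le)
    then show ?thesis using y by (simp add: trig_poly_def mult_ac)
  qed
  have ne: "torus d \<noteq> {}" by (simp add: torus_def PiE_eq_empty_iff)
  then obtain y0 where "y0 \<in> torus d" by blast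
  \<comment> \<open>The zero polynomial shows \<open>0 \<le> E\<close>, which is used when the root
    is taken at the end.\<close>
  from bound[of "{}" y0, OF _ _ this] have E0: "0 \<le> E" by (simp add: ip_def)
  have part: "sum lam F \<le> E\<^sup>2" if F: "finite F" "F \<subseteq> Zd d - J" for F
  proof -
    \<comment> \<open>\<open>J\<close> is joined to \<open>F\<close> so that it consists of largest
      weights within a finite set.\<close>
    have FJ: "finite (F \<union> J)" "F \<union> J \<subseteq> Zd d" using F J by auto
    obtain X where X: "finite X" "X \<noteq> {}" "X \<subseteq> torus d"
      and orth: "\<And>k k'. k \<in> F \<union> J \<Longrightarrow> k' \<in> F \<union> J \<Longrightarrow>
        (\<Sum>y\<in>X. ekx d k y * cnj (ekx d k' y)) = (if k = k' then of_nat (card X) else 0)"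
      using torus_grid[OF FJ] by metis
    have "(\<Sum>k\<in>(F \<union> J) - J. lam k) \<le> E\<^sup>2"
    proof (rule trace_lower_bound[OF FJ(1) _ J(3) _ _ X(1,2) orth])
      show "lam k' \<le> lam k" if "k \<in> J" "k' \<in> F \<union> J - J" for k k' using top F that by blast
      show "0 \<le> lam k" for k by (simp add: lam_def)
      fix a y
      assume "\<And>i. i < m \<Longrightarrow> ip (F \<union> J) a (\<lambda>k. cnj (of_real (sqrt (lam k)) * (Ls ! i) (trig_poly d {k} (\<lambda>_. 1)))) = 0"
        "(\<Sum>k\<in>F \<union> J. (cmod (a k))\<^sup>2) \<le> 1" "y \<in> X"
      then show "cmod (\<Sum>k\<in>F \<union> J. a k * (of_real (sqrt (lam k)) * ekx d k y)) \<le> E"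
        using X(3) by (intro bound FJ) auto
    qed auto
    moreover have "(F \<union> J) - J = F" using F by auto
    ultimately show ?thesis by simp
  qed
  have "infsum lam (Zd d - J) \<le> E\<^sup>2"
    by (rule infsum_le_finite_sums[OF summable_on_subset_banach[OF lam_summable] part]) auto
  then have "sqrt (infsum lam (Zd d - J)) \<le> sqrt (E\<^sup>2)" by (rule real_sqrt_le_mono)
  then show "ereal (sqrt (infsum lam (Zd d - J))) \<le> ereal E" using E0 by simp
qed

text \<open>The algorithm returns any element of the unit ball with the observed values. Its
  difference from \<open>f\<close> vanishes at the sample points and has squared norm at most 4, so
  \<open>sampling_points\<close> bounds the squared difference by \<open>64 * t * 4\<close>; the
  root gives the factor 16.\<close>

lemma err_Lstd_le_tail:
  assumes J: "finite J" "card J \<le> m" and m: "1 \<le> m"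
  obtains n where "n < 2 * m" "err \<omega> d (Lstd d) n \<le> ereal (16 * sqrt (infsum lam (Zd d - J)))"
proof -
  define t where "t = infsum lam (Zd d - J)"
  have summ_t: "lam summable_on Zd d - J" using lam_summable by (rule summable_on_subset_banach) auto
  have t: "sum lam F \<le> t" if "finite F" "F \<subseteq> Zd d - J" for F
    unfolding t_def using that by (intro finite_sum_le_infsum summ_t) (auto simp: lam_def)
  obtain n x where n: "n < 2 * m" and x: "\<forall>i<n. x i \<in> torus d"
    and samp: "\<forall>c h M y. (\<forall>F. finite F \<longrightarrow> F \<subseteq> Zd d \<longrightarrow> (\<Sum>k\<in>F. (cmod (c k))\<^sup>2 / lam k) \<le> M) \<longrightarrow>
      (\<forall>y\<in>torus d. ((\<lambda>k. c k * ekx d k y) has_sum h y) (Zd d)) \<longrightarrow>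
      (\<forall>i<n. h (x i) = 0) \<longrightarrow> y \<in> torus d \<longrightarrow> (cmod (h y))\<^sup>2 \<le> 64 * t * M"
    by (rule sampling_points[OF J m t])
  define Ls :: "(fn \<Rightarrow> complex) list" where "Ls = map (\<lambda>i f. f (x i)) [0..<n]"
  \<comment> \<open>For data of some \<open>f\<close> in the unit ball, \<open>f\<close> itself is a
    candidate for the choice.\<close>
  define \<phi> where "\<phi> ys = (SOME f. f \<in> unitball \<omega> d \<and> map (\<lambda>L. L f) Ls = ys)" for ys
  have diff: "cmod (f y - g y) \<le> 16 * sqrt t"
    if f: "f \<in> unitball \<omega> d" and g: "g \<in> unitball \<omega> d" and eq: "map (\<lambda>L. L g) Ls = map (\<lambda>L. L f) Ls"
      and y: "y \<in> torus d" for f g y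
  proof -
    have "(cmod (f y - g y))\<^sup>2 \<le> 64 * t * 4"
    proof (rule samp[rule_format, where c = "\<lambda>k. fhat d f k - fhat d g k" and h = "\<lambda>y. f y - g y"])
      fix F assume F: "finite F" "F \<subseteq> Zd d"
      have "(\<Sum>k\<in>F. (cmod (fhat d f k - fhat d g k))\<^sup>2 / lam k) \<le>
          (\<Sum>k\<in>F. 2 * ((cmod (fhat d f k))\<^sup>2 * (\<omega> d k)\<^sup>2) + 2 * ((cmod (fhat d g k))\<^sup>2 * (\<omega> d k)\<^sup>2))"
      proof (rule sum_mono)
        fix k
        have "(cmod (fhat d f k - fhat d g k))\<^sup>2 \<le> (cmod (fhat d f k) + cmod (fhat d g k))\<^sup>2"
          by (intro power_mono norm_triangle_ineq4) auto
        also have "\<dots> \<le> 2 * (cmod (fhat d f k))\<^sup>2 + 2 * (cmod (fhat d g k))\<^sup>2"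
          using zero_le_power2[of "cmod (fhat d f k) - cmod (fhat d g k)"] by (simp add: power2_eq_square algebra_simps)
        finally have "(cmod (fhat d f k - fhat d g k))\<^sup>2 * (\<omega> d k)\<^sup>2 \<le>
            (2 * (cmod (fhat d f k))\<^sup>2 + 2 * (cmod (fhat d g k))\<^sup>2) * (\<omega> d k)\<^sup>2"
          by (rule mult_right_mono) simp
        then show "(cmod (fhat d f k - fhat d g k))\<^sup>2 / lam k \<le>
            2 * ((cmod (fhat d f k))\<^sup>2 * (\<omega> d k)\<^sup>2) + 2 * ((cmod (fhat d g k))\<^sup>2 * (\<omega> d k)\<^sup>2)"
          by (simp add: lam_def algebra_simps)
      qed
      also have "\<dots> \<le> 4"
        using unitball_coeff[OF f F] unitball_coeff[OF g F] by (simp add: sum.distrib flip: sum_distrib_left)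
      finally show "(\<Sum>k\<in>F. (cmod (fhat d f k - fhat d g k))\<^sup>2 / lam k) \<le> 4" .
    next
      fix z assume "z \<in> torus d"
      then have "((\<lambda>k. fhat d f k * ekx d k z) has_sum f z) (Zd d)" "((\<lambda>k. fhat d g k * ekx d k z) has_sum g z) (Zd d)"
        using f g by (auto simp: unitball_def Hsp_def)
      from has_sum_add[OF this(1) has_sum_cmult_right[OF this(2), of "- 1"]]
      show "((\<lambda>k. (fhat d f k - fhat d g k) * ekx d k z) has_sum (f z - g z)) (Zd d)"
        by (simp add: algebra_simps)
    next
      show "f (x i) - g (x i) = 0" if "i < n" for i
        using arg_cong[OF eq, of "\<lambda>ys. ys ! i"] that by (simp add: Ls_def)
    qed (rule y)
    then have "sqrt ((cmod (f y - g y))\<^sup>2) \<le> sqrt (16\<^sup>2 * t)" by (intro real_sqrt_le_mono) simp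
    then show ?thesis by (simp add: real_sqrt_mult)
  qed
  have "err \<omega> d (Lstd d) n \<le> (SUP f\<in>unitball \<omega> d. Linf d (\<lambda>y. f y - \<phi> (map (\<lambda>L. L f) Ls) y))"
    unfolding err_def by (rule INF_lower2[of "(Ls, \<phi>)"]) (use x in \<open>auto simp: Ls_def Lstd_def\<close>)
  also have "\<dots> \<le> ereal (16 * sqrt t)"
  proof (rule SUP_least)
    fix f assume f: "f \<in> unitball \<omega> d"
    then have "\<phi> (map (\<lambda>L. L f) Ls) \<in> unitball \<omega> d \<and> map (\<lambda>L. L (\<phi> (map (\<lambda>L. L f) Ls))) Ls = map (\<lambda>L. L f) Ls"
      unfolding \<phi>_def by (intro someI_ex[of "\<lambda>g. g \<in> unitball \<omega> d \<and> map (\<lambda>L. L g) Ls = map (\<lambda>L. L f) Ls"]) blast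
    then show "Linf d (\<lambda>y. f y - \<phi> (map (\<lambda>L. L f) Ls) y) \<le> ereal (16 * sqrt t)"
      unfolding Linf_def using diff[OF f] by (intro Inf_lower) (auto intro!: bexI[of _ "{}"])
  qed
  finally show ?thesis using n that by (simp add: t_def)
qed

text \<open>The tail beyond the \<open>m + 1\<close> largest weights controls the sampling error and
  lies below the error of \<open>m\<close> functionals. Taking \<open>m + 1\<close> covers
  \<open>m = 0\<close>, since \<open>err_Lstd_le_tail\<close> asks for a positive size.\<close>

lemma err_Lstd_le_err_Lall:
  obtains n where "n \<le> 2 * (m + 1)" "err \<omega> d (Lstd d) n \<le> 16 * err \<omega> d (Lall \<omega> d) m"
proof -
  obtain J where J: "J \<subseteq> Zd d" "finite J" "card J = m + 1" "\<And>k k'. k \<in> J \<Longrightarrow> k' \<in> Zd d - J \<Longrightarrow> lam k' \<le> lam k"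
    by (rule exists_top_set[OF infinite_Zd[OF d] lam_pos lam_summable]) blast+
  obtain n where n: "n < 2 * (m + 1)" "err \<omega> d (Lstd d) n \<le> ereal (16 * sqrt (infsum lam (Zd d - J)))"
    using err_Lstd_le_tail[OF J(2), of "m + 1"] J(3) by auto
  note n(2)
  also have "ereal (16 * sqrt (infsum lam (Zd d - J))) = 16 * ereal (sqrt (infsum lam (Zd d - J)))"
    by simp
  also have "\<dots> \<le> 16 * err \<omega> d (Lall \<omega> d) m"
    using J by (intro ereal_mult_left_mono tail_le_err_Lall) auto
  finally have "err \<omega> d (Lstd d) n \<le> 16 * err \<omega> d (Lall \<omega> d) m" .
  with n(1) show ?thesis by (intro that[of n]) simp_all
qed

end

section \<open>Information complexity and tractability exponents\<close>

lemma err_antimono_class: "Lam \<subseteq> Lam' \<Longrightarrow> err \<omega> d Lam' n \<le> err \<omega> d Lam n"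
  unfolding err_def by (rule INF_superset_mono) auto

lemma nstar_le: "err \<omega> d (Lam d) n \<le> ereal \<epsilon> * CRI c \<omega> d \<Longrightarrow> nstar c \<omega> Lam \<epsilon> d \<le> enat n"
  unfolding nstar_def by (rule Inf_lower) auto

text \<open>A finite infimum of natural numbers is attained, whereas the empty set has infimum
  infinity.\<close>

lemma nstar_eq_enatD:
  assumes "nstar c \<omega> Lam \<epsilon> d = enat n"
  shows "err \<omega> d (Lam d) n \<le> ereal \<epsilon> * CRI c \<omega> d"
proof -
  let ?A = "{enat n | n. err \<omega> d (Lam d) n \<le> ereal \<epsilon> * CRI c \<omega> d}"
  have "?A \<noteq> {}"
  proof
    assume "?A = {}"
    then have "nstar c \<omega> Lam \<epsilon> d = \<infinity>" unfolding nstar_def by (simp only: Inf_enat_def) simp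
    with assms show False by simp
  qed
  then have "Inf ?A \<in> ?A" by (auto simp: Inf_enat_def intro: LeastI)
  with assms show ?thesis by (auto simp: nstar_def)
qed

text \<open>One admissible \<open>n\<close> makes the infimum in \<open>nstar\<close> finite and
  passes its estimate on to it.\<close>

lemma bound_holdsI:
  assumes "\<And>d \<epsilon>. 1 \<le> d \<Longrightarrow> 0 < \<epsilon> \<Longrightarrow> \<epsilon> < 1 \<Longrightarrow> \<exists>n. err \<omega> d (Lam d) n \<le> ereal \<epsilon> * CRI c \<omega> d \<and>
    real n \<le> C * real d powr q * \<epsilon> powr (- p)"
  shows "bound_holds c \<omega> Lam C p q"
  unfolding bound_holds_def
proof (intro allI impI)
  fix d :: nat and \<epsilon> :: real assume "1 \<le> d" "0 < \<epsilon> \<and> \<epsilon> < 1"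
  then obtain n where n: "err \<omega> d (Lam d) n \<le> ereal \<epsilon> * CRI c \<omega> d" "real n \<le> C * real d powr q * \<epsilon> powr (- p)"
    using assms by blast
  obtain n' where "nstar c \<omega> Lam \<epsilon> d = enat n'" "n' \<le> n"
    using nstar_le[of \<omega> d Lam n, OF n(1)] by (cases "nstar c \<omega> Lam \<epsilon> d") auto
  with n(2) show "\<exists>n. nstar c \<omega> Lam \<epsilon> d = enat n \<and> real n \<le> C * real d powr q * \<epsilon> powr (- p)"
    by (intro exI[of _ n']) auto
qed

lemma bound_holdsD:
  assumes "bound_holds c \<omega> Lam C p q" "1 \<le> d" "0 < \<epsilon>" "\<epsilon> < 1"
  obtains n where "err \<omega> d (Lam d) n \<le> ereal \<epsilon> * CRI c \<omega> d" "real n \<le> C * real d powr q * \<epsilon> powr (- p)"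
proof -
  obtain n where "nstar c \<omega> Lam \<epsilon> d = enat n" "real n \<le> C * real d powr q * \<epsilon> powr (- p)"
    using assms unfolding bound_holds_def by blast
  then show ?thesis using nstar_eq_enatD that by blast
qed

theorem theorem4p1:
  fixes \<omega> :: weight and c :: crit
  assumes pos: "\<And>d k. d \<ge> 1 \<Longrightarrow> k \<in> Zd d \<Longrightarrow> \<omega> d k > 0"
    and summ: "\<And>d. d \<ge> 1 \<Longrightarrow> (\<lambda>k. (\<omega> d k) powr (-2)) summable_on Zd d"
  shows "(ALG_PT c \<omega> (Lall \<omega>) \<longleftrightarrow> ALG_PT c \<omega> Lstd)
       \<and> (ALG_SPT c \<omega> (Lall \<omega>) \<longleftrightarrow> ALG_SPT c \<omega> Lstd)
       \<and> (ALG_SPT c \<omega> (Lall \<omega>) \<longrightarrow> ALG_pstar c \<omega> (Lall \<omega>) = ALG_pstar c \<omega> Lstd)"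
proof -
  have weights: "weights \<omega> d" if "1 \<le> d" for d
    using that pos summ by unfold_locales auto
  \<comment> \<open>Point evaluations are continuous functionals, so the larger class has no larger
    error.\<close>
  have std_all: "bound_holds c \<omega> (Lall \<omega>) C p q" if "bound_holds c \<omega> Lstd C p q" for C p q
  proof (rule bound_holdsI)
    fix d :: nat and \<epsilon> :: real assume d: "1 \<le> d" and \<epsilon>: "0 < \<epsilon>" "\<epsilon> < 1"
    obtain n where n: "err \<omega> d (Lstd d) n \<le> ereal \<epsilon> * CRI c \<omega> d" "real n \<le> C * real d powr q * \<epsilon> powr (- p)"
      by (rule bound_holdsD[OF \<open>bound_holds c \<omega> Lstd C p q\<close> d \<epsilon>])
    show "\<exists>n. err \<omega> d (Lall \<omega> d) n \<le> ereal \<epsilon> * CRI c \<omega> d \<and> real n \<le> C * real d powr q * \<epsilon> powr (- p)"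
      using n order_trans[OF err_antimono_class[OF weights.Lstd_subset_Lall[OF weights[OF d]]]] by blast
  qed
  \<comment> \<open>The factor 16 is absorbed by passing to \<open>\<epsilon> / 16\<close>, which
    costs \<open>16 powr p\<close>; \<open>CRI\<close> is the same for both classes. The factor 2
    and the summand 2 come from \<open>n \<le> 2 * (m + 1)\<close>.\<close>
  have all_std: "bound_holds c \<omega> Lstd (2 * C * 16 powr p + 2) p q"
    if all: "bound_holds c \<omega> (Lall \<omega>) C p q" and p: "0 \<le> p" and q: "0 \<le> q" for C p q
  proof (rule bound_holdsI)
    fix d :: nat and \<epsilon> :: real assume d: "1 \<le> d" and \<epsilon>: "0 < \<epsilon>" "\<epsilon> < 1"
    obtain m where m: "err \<omega> d (Lall \<omega> d) m \<le> ereal (\<epsilon> / 16) * CRI c \<omega> d"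
      "real m \<le> C * real d powr q * (\<epsilon> / 16) powr (- p)"
      by (rule bound_holdsD[OF all d, of "\<epsilon> / 16"]) (use \<epsilon> in auto)
    obtain n where n: "n \<le> 2 * (m + 1)" "err \<omega> d (Lstd d) n \<le> 16 * err \<omega> d (Lall \<omega> d) m"
      by (rule weights.err_Lstd_le_err_Lall[OF weights[OF d]])
    note n(2)
    also have "16 * err \<omega> d (Lall \<omega> d) m \<le> 16 * (ereal (\<epsilon> / 16) * CRI c \<omega> d)"
      using m(1) by (intro ereal_mult_left_mono) auto
    also have "\<dots> = ereal \<epsilon> * CRI c \<omega> d"
      by (simp flip: mult.assoc)
    finally have "err \<omega> d (Lstd d) n \<le> ereal \<epsilon> * CRI c \<omega> d" .
    moreover have "real n \<le> (2 * C * 16 powr p + 2) * real d powr q * \<epsilon> powr (- p)"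
    proof -
      have eq: "(\<epsilon> / 16) powr (- p) = 16 powr p * \<epsilon> powr (- p)"
        using \<epsilon> by (simp add: powr_divide powr_minus field_simps)
      have "1 \<le> real d powr q" using d q by (simp add: ge_one_powr_ge_zero)
      moreover have "1 \<le> \<epsilon> powr (- p)"
        using \<epsilon> p by (simp add: powr_minus powr_le1 one_le_inverse_iff)
      \<comment> \<open>This lets the additive 2 be absorbed into the product.\<close>
      ultimately have "1 * 1 \<le> real d powr q * \<epsilon> powr (- p)" by (intro mult_mono) auto
      moreover have "real n \<le> 2 * real m + 2" using of_nat_mono[OF n(1), where 'a = real] by simp
      ultimately have "real n \<le> 2 * (C * real d powr q * (16 powr p * \<epsilon> powr (- p))) + 2 * (real d powr q * \<epsilon> powr (- p))"
        using m(2) unfolding eq by linarith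
      then show ?thesis by (simp add: algebra_simps)
    qed
    ultimately show "\<exists>n. err \<omega> d (Lstd d) n \<le> ereal \<epsilon> * CRI c \<omega> d \<and>
        real n \<le> (2 * C * 16 powr p + 2) * real d powr q * \<epsilon> powr (- p)" by blast
  qed
  \<comment> \<open>The equivalence holds for each pair of exponents separately, with only
    \<open>C\<close> changing, so the sets defining \<open>ALG_pstar\<close> coincide.\<close>
  have iff: "(\<exists>C>0. bound_holds c \<omega> (Lall \<omega>) C p q) \<longleftrightarrow> (\<exists>C>0. bound_holds c \<omega> Lstd C p q)" if "0 \<le> p" "0 \<le> q" for p q
  proof
    assume "\<exists>C>0. bound_holds c \<omega> (Lall \<omega>) C p q"
    then obtain C where "0 < C" "bound_holds c \<omega> (Lall \<omega>) C p q" by blast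
    with all_std[OF this(2) that] show "\<exists>C>0. bound_holds c \<omega> Lstd C p q"
      by (intro exI[of _ "2 * C * 16 powr p + 2"]) (auto intro: add_nonneg_pos)
  qed (use std_all in blast)
  have "ALG_PT c \<omega> (Lall \<omega>) \<longleftrightarrow> ALG_PT c \<omega> Lstd"
    unfolding ALG_PT_def using iff by blast
  moreover have "ALG_SPT c \<omega> (Lall \<omega>) \<longleftrightarrow> ALG_SPT c \<omega> Lstd"
    unfolding ALG_SPT_def using iff[OF _ order_refl] by blast
  moreover have "ALG_pstar c \<omega> (Lall \<omega>) = ALG_pstar c \<omega> Lstd"
    unfolding ALG_pstar_def using iff[of _ 0] by (intro arg_cong[where f = Inf] Collect_cong) auto
  ultimately show ?thesis by blast
qed

end
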